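(* Let $\Omega$ be a bounded domain of $\mathbb{R}^N$, $N\ge3$, containing the origin. Then $u\in H(\Omega)$ if and only if $v:=|x|^{\frac{N-2}{2}}u\in W_0^{1,2}(|x|^{-(N-2)},\Omega)$. In this case the norms are related by $$\|u\|^2_{H(\Omega)}=\|v\|^2_{W_0^{1,2}(|x|^{-(N-2)},\Omega)},$$ that is, $$\int_\Omega|\nabla u|^2\,dx-\left(\frac{N-2}{2}\right)^2\int_\Omega\frac{u^2}{|x|^2}\,dx-L^2(u)=\int_\Omega|x|^{-(N-2)}|\nabla v|^2\,dx.$$
   Context: $W_0^{1,2}(|x|^{-(N-2)},\Omega)$ is the completion of $C_0^\infty(\Omega)$ under the norm $\|v\|^2=\int_\Omega|x|^{-(N-2)}|\nabla v|^2dx$. $H(\Omega)$ is the completion of the set $\{|x|^{-\frac{N-2}{2}}\phi(x):\phi\in C_0^\infty(\Omega)\}$ under the norm $$\|u\|_{H(\Omega)}^2=\int_\Omega|\nabla u|^2dx-\left(\frac{N-2}{2}\right)^2\int_\Omega\frac{u^2}{|x|^2}dx-L^2(u).$$ Here $L(u)=\left(\frac{N(N-2)}{2}\omega_N\right)^{1/2}\lim_{|x|\to0}|x|^{\frac{N-2}{2}}u_r(|x|)$, where $\omega_N$ is the Lebesgue measure of the unit ball of $\mathbb{R}^N$ and $u_r$ is the radial part of $u$: extending $u$ by zero outside $\Omega$, $u_r(\rho)=\frac1{|\partial B_\rho|}\int_{\partial B_\rho}u\,ds$. The difference of the two integrals in the norm is understood as the limit as $\varepsilon\to0$ of the same difference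 over $\Omega\setminus B_\varepsilon(0)$ for $u$ in the dense set above, and the whole expression is extended to $H(\Omega)$ by completion. *)

theory Defs
  imports "HOL-Analysis.Analysis"
begin

text \<open>Throughout, the ambient space is a Euclidean space \<open>'a\<close> of dimension \<open>N = DIM('a)\<close>.\<close>

definition grad :: "('a::euclidean_space \<Rightarrow> real) \<Rightarrow> 'a \<Rightarrow> 'a"
  where "grad f x = (THE D. GDERIV f x :> D)"

primrec Ck :: "nat \<Rightarrow> ('a::euclidean_space \<Rightarrow> real) \<Rightarrow> bool" where
  "Ck 0 f \<longleftrightarrow> continuous_on UNIV f"
| "Ck (Suc k) f \<longleftrightarrow>
     (\<forall>x. f differentiable (at x)) \<and> (\<forall>b\<in>Basis. Ck k (\<lambda>x. grad f x \<bullet> b))"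

definition test_functions :: "'a::euclidean_space set \<Rightarrow> ('a \<Rightarrow> real) set"
  where "test_functions \<Omega> =
    {\<phi>. (\<forall>k. Ck k \<phi>) \<and> compact (closure {x. \<phi> x \<noteq> 0}) \<and> closure {x. \<phi> x \<noteq> 0} \<subseteq> \<Omega>}"

definition hardy_exp :: "'a::euclidean_space itself \<Rightarrow> real"
  where "hardy_exp _ = (real DIM('a) - 2) / 2"

definition weight :: "'a::euclidean_space \<Rightarrow> real"
  where "weight x = norm x powr (- (real DIM('a) - 2))"

text \<open>
  Both completions are realised as spaces of functions on \<open>\<Omega>\<close>. A Cauchy sequence of a
  space \<open>D\<close> of functions, normed by \<open>nrm\<close>, represents its limit \<open>u\<close> in \<open>L\<^sup>2(\<Omega>)\<close>. For the two
  spaces below, on a bounded domain, Cauchy sequences do converge in \<open>L\<^sup>2(\<Omega>)\<close> (weighted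
  Poincare inequality, respectively the improved Hardy inequality), and two of them have
  the same limit iff their difference is a null sequence for \<open>nrm\<close>. So the functions
  (modulo equality almost everywhere on \<open>\<Omega>\<close>) are exactly the elements of the abstract
  completion.
\<close>

definition represents ::
  "'a::euclidean_space set \<Rightarrow> ('a \<Rightarrow> real) set \<Rightarrow> (('a \<Rightarrow> real) \<Rightarrow> real)
     \<Rightarrow> (nat \<Rightarrow> 'a \<Rightarrow> real) \<Rightarrow> ('a \<Rightarrow> real) \<Rightarrow> bool"
  where "represents \<Omega> D nrm f u \<longleftrightarrow>
    (\<forall>n. f n \<in> D) \<and>
    (\<forall>e>0. \<exists>M. \<forall>m\<ge>M. \<forall>n\<ge>M. nrm (\<lambda>x. f m x - f n x) < e) \<and>
    u \<in> borel_measurable (lebesgue_on \<Omega>) \<and>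
    (\<lambda>n. \<integral>\<^sup>+x. ennreal ((f n x - u x)\<^sup>2) \<partial>lebesgue_on \<Omega>) \<longlonglongrightarrow> 0"

definition completion_of ::
  "'a::euclidean_space set \<Rightarrow> ('a \<Rightarrow> real) set \<Rightarrow> (('a \<Rightarrow> real) \<Rightarrow> real) \<Rightarrow> ('a \<Rightarrow> real) set"
  where "completion_of \<Omega> D nrm = {u. \<exists>f. represents \<Omega> D nrm f u}"

definition completion_norm ::
  "'a::euclidean_space set \<Rightarrow> ('a \<Rightarrow> real) set \<Rightarrow> (('a \<Rightarrow> real) \<Rightarrow> real) \<Rightarrow> ('a \<Rightarrow> real) \<Rightarrow> real"
  where "completion_norm \<Omega> D nrm u =
    (THE r. \<exists>f. represents \<Omega> D nrm f u \<and> (\<lambda>n. nrm (f n)) \<longlonglongrightarrow> r)"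

section \<open>The weighted Sobolev space\<close>

definition W_prenorm :: "'a::euclidean_space set \<Rightarrow> ('a \<Rightarrow> real) \<Rightarrow> real"
  where "W_prenorm \<Omega> v = sqrt (LINT x:\<Omega>|lebesgue. weight x * (norm (grad v x))\<^sup>2)"

definition W_space :: "'a::euclidean_space set \<Rightarrow> ('a \<Rightarrow> real) set"
  where "W_space \<Omega> = completion_of \<Omega> (test_functions \<Omega>) (W_prenorm \<Omega>)"

definition W_norm :: "'a::euclidean_space set \<Rightarrow> ('a \<Rightarrow> real) \<Rightarrow> real"
  where "W_norm \<Omega> v = completion_norm \<Omega> (test_functions \<Omega>) (W_prenorm \<Omega>) v"

text \<open>The gradient of a non-smooth element is the distributional one.\<close>

definition has_weak_gradient ::
  "'a::euclidean_space set \<Rightarrow> ('a \<Rightarrow> real) \<Rightarrow> ('a \<Rightarrow> 'a) \<Rightarrow> bool"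
  where "has_weak_gradient \<Omega> v g \<longleftrightarrow>
    (\<forall>K. compact K \<and> K \<subseteq> \<Omega> \<longrightarrow> set_integrable lebesgue K v \<and> set_integrable lebesgue K g) \<and>
    (\<forall>\<phi>\<in>test_functions \<Omega>.
       (LINT x:\<Omega>|lebesgue. v x *\<^sub>R grad \<phi> x) = - (LINT x:\<Omega>|lebesgue. \<phi> x *\<^sub>R g x))"

section \<open>The space \<open>H(\<Omega>)\<close>\<close>

text \<open>
  Surface measure on the sphere of radius \<open>\<rho>\<close> about the origin, as in polar coordinates:
  the area of \<open>A \<subseteq> sphere 0 1\<close> is \<open>N\<close> times the volume of the cone
  \<open>{t *\<^sub>R a | t a. 0 < t < 1 \<and> a \<in> A}\<close>, and areas scale by \<open>\<rho> ^ (N - 1)\<close>.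
\<close>

definition sphere_measure :: "real \<Rightarrow> 'a::euclidean_space measure"
  where "sphere_measure \<rho> =
    scale_measure (ennreal (real DIM('a) * \<rho> ^ (DIM('a) - 1)))
      (distr (restrict_space lborel (ball (0::'a) 1)) borel (\<lambda>x. \<rho> *\<^sub>R sgn x))"

definition radial_part :: "'a::euclidean_space set \<Rightarrow> ('a \<Rightarrow> real) \<Rightarrow> real \<Rightarrow> real"
  where "radial_part \<Omega> u \<rho> =
    (LINT x|sphere_measure \<rho>. (if x \<in> \<Omega> then u x else 0))
      / measure (sphere_measure \<rho> :: 'a measure) (sphere 0 \<rho>)"

definition L_functional :: "'a::euclidean_space set \<Rightarrow> ('a \<Rightarrow> real) \<Rightarrow> real"
  where "L_functional \<Omega> u =
    sqrt (real DIM('a) * (real DIM('a) - 2) / 2 * measure lebesgue (ball (0::'a) 1))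
      * Lim (at_right 0) (\<lambda>\<rho>. \<rho> powr hardy_exp TYPE('a) * radial_part \<Omega> u \<rho>)"

text \<open>At the origin the functions below have the value 0, since \<open>0 powr a = 0\<close>.\<close>

definition H_core :: "'a::euclidean_space set \<Rightarrow> ('a \<Rightarrow> real) set"
  where "H_core \<Omega> =
    {\<lambda>x. norm x powr (- hardy_exp TYPE('a)) * \<phi> x | \<phi>. \<phi> \<in> test_functions \<Omega>}"

definition H_energy :: "'a::euclidean_space set \<Rightarrow> ('a \<Rightarrow> real) \<Rightarrow> real"
  where "H_energy \<Omega> u =
    Lim (at_right 0) (\<lambda>\<epsilon>.
        (LINT x:(\<Omega> - ball 0 \<epsilon>)|lebesgue. (norm (grad u x))\<^sup>2)
      - (hardy_exp TYPE('a))\<^sup>2 * (LINT x:(\<Omega> - ball 0 \<epsilon>)|lebesgue. (u x)\<^sup>2 / (norm x)\<^sup>2))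
    - (L_functional \<Omega> u)\<^sup>2"

definition H_prenorm :: "'a::euclidean_space set \<Rightarrow> ('a \<Rightarrow> real) \<Rightarrow> real"
  where "H_prenorm \<Omega> u = sqrt (H_energy \<Omega> u)"

definition H_space :: "'a::euclidean_space set \<Rightarrow> ('a \<Rightarrow> real) set"
  where "H_space \<Omega> = completion_of \<Omega> (H_core \<Omega>) (H_prenorm \<Omega>)"

text \<open>
  For \<open>u\<close> in \<open>H(\<Omega>)\<close>, the value \<open>(H_norm \<Omega> u)\<^sup>2\<close> is the extension by completion of \<open>H_energy \<Omega>\<close>;
  the separate terms of \<open>H_energy\<close> need not make sense for such \<open>u\<close>.
\<close>

definition H_norm :: "'a::euclidean_space set \<Rightarrow> ('a \<Rightarrow> real) \<Rightarrow> real"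
  where "H_norm \<Omega> u = completion_norm \<Omega> (H_core \<Omega>) (H_prenorm \<Omega>) u"

end

theory Submission
  imports Defs
begin

text \<open>
  Put \<open>a = (N - 2) / 2\<close> and let \<open>u = |x|^(-a) \<phi>\<close> with \<open>\<phi>\<close> of class \<open>C\<^sup>1\<close> and compactly supported.
  Expanding the square gives, away from the origin,
  \<open>|\<nabla>u|\<^sup>2 - a\<^sup>2 u\<^sup>2 / |x|\<^sup>2 = |x|^(2-N) |\<nabla>\<phi>|\<^sup>2 - a |x|^(-N) x \<bullet> \<nabla>(\<phi>\<^sup>2)\<close>. In polar coordinates the last
  term is a radial derivative, so over \<open>|x| \<ge> \<epsilon>\<close> it integrates to a spherical mean of \<open>\<phi>\<^sup>2\<close>, and
  as \<open>\<epsilon> \<rightarrow> 0\<close> it contributes \<open>a N \<omega>\<^sub>N (\<phi> 0)\<^sup>2 = L\<^sup>2(u)\<close>. Thus \<open>\<phi> \<mapsto> u\<close> is an isometry of the dense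
  sets. It respects the \<open>L\<^sup>2\<close> limits that represent the elements of the completions because of
  the weighted Poincare inequality, which comes from the same radial identity with \<open>|x|^(2-N) x\<close>
  in place of \<open>|x|^(-N) x\<close>. The gradients of a Cauchy sequence converge in the weighted \<open>L\<^sup>2\<close>
  space to a weak gradient of the limit, and integration by parts shows that this gradient
  depends only on the represented function.
\<close>

section \<open>Square integrable functions\<close>

text \<open>Both completions are realised inside the unweighted L2 space of the domain, and there
  the isometry of the dense sets is unbounded in one direction. Multiplication by
  \<open>|x|^a\<close> is at most \<open>R^a\<close> on a domain inside the ball of radius R, so
  limits pass from H to W at once; multiplication by \<open>|x|^(-a)\<close> need not preserve L2
  convergence. The Poincare inequality closes this gap: a Cauchy sequence for the W norm is still
  Cauchy in L2 after that multiplication, and an almost everywhere convergent subsequence identifies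
  its limit. The norm of a completion is a \<open>THE\<close> over all representing sequences, so
  the weighted gradient has to be closable. This needs neither mollification nor a density argument,
  because the difference of two limit gradients is itself a limit of gradients of smooth functions
  and can be tested against them. If \<open>\<phi> 0 \<noteq> 0\<close>, both integrals in the
  energy diverge at the origin like the integral of \<open>|x|^(-N)\<close>. Hence the cancellation
  takes place at a fixed \<open>\<epsilon> > 0\<close>, and only an integrable remainder is taken to
  the limit.\<close>

definition square_integrable :: "'a measure \<Rightarrow> ('a \<Rightarrow> 'b::euclidean_space) \<Rightarrow> bool"
  where "square_integrable M f \<longleftrightarrow> f \<in> borel_measurable M \<and> integrable M (\<lambda>x. (norm (f x))\<^sup>2)"

text \<open>Nonnegative integrals, as in \<open>represents\<close>, give this a meaning before the
  limit is known to be square integrable; a Bochner integral would be 0 for an error that is not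
  square integrable.\<close>

definition L2_tendsto :: "'a measure \<Rightarrow> (nat \<Rightarrow> 'a \<Rightarrow> 'b::euclidean_space) \<Rightarrow> ('a \<Rightarrow> 'b) \<Rightarrow> bool"
  where "L2_tendsto M F G \<longleftrightarrow> (\<lambda>n. \<integral>\<^sup>+x. ennreal ((norm (F n x - G x))\<^sup>2) \<partial>M) \<longlonglongrightarrow> 0"

lemma square_integrable_iff:
  "square_integrable M f \<longleftrightarrow>
     f \<in> borel_measurable M \<and> (\<integral>\<^sup>+x. ennreal ((norm (f x))\<^sup>2) \<partial>M) < \<infinity>"
  by (auto simp: square_integrable_def integrable_iff_bounded)

lemma square_integrable_nn_integral:
  assumes "square_integrable M f"
  shows "(\<integral>\<^sup>+x. ennreal ((norm (f x))\<^sup>2) \<partial>M) = ennreal (LINT x|M. (norm (f x))\<^sup>2)"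
  using assms by (intro nn_integral_eq_integral) (auto simp: square_integrable_def)

lemma norm_add_square_le:
  fixes a b :: "'b::real_inner"
  shows "(norm (a + b))\<^sup>2 \<le> 2 * (norm a)\<^sup>2 + 2 * (norm b)\<^sup>2"
proof -
  have "(norm (a + b))\<^sup>2 \<le> (norm (a + b))\<^sup>2 + (norm (a - b))\<^sup>2" by simp
  also have "\<dots> = 2 * (norm a)\<^sup>2 + 2 * (norm b)\<^sup>2"
    by (simp add: power2_norm_eq_inner inner_add inner_diff inner_commute)
  finally show ?thesis .
qed

lemma norm_diff_square_le:
  fixes a b :: "'b::real_inner"
  shows "(norm (a - b))\<^sup>2 \<le> 2 * (norm a)\<^sup>2 + 2 * (norm b)\<^sup>2"
  using norm_add_square_le[of a "- b"] by simp

lemma square_integrable_diff: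
  assumes f: "square_integrable M f" and g: "square_integrable M g"
  shows "square_integrable M (\<lambda>x. f x - g x)"
  unfolding square_integrable_def
proof
  show m: "(\<lambda>x. f x - g x) \<in> borel_measurable M"
    using f g by (auto simp: square_integrable_def)
  have "integrable M (\<lambda>x. 2 * (norm (f x))\<^sup>2 + 2 * (norm (g x))\<^sup>2)"
    using f g by (auto simp: square_integrable_def)
  then show "integrable M (\<lambda>x. (norm (f x - g x))\<^sup>2)"
    by (rule Bochner_Integration.integrable_bound) (use m in \<open>auto intro!: norm_diff_square_le\<close>)
qed

lemma square_integrable_inner_const:
  assumes f: "square_integrable M f"
  shows "square_integrable M (\<lambda>x. f x \<bullet> b)"
  unfolding square_integrable_def
proof
  show m: "(\<lambda>x. f x \<bullet> b) \<in> borel_measurable M"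
    using f by (auto simp: square_integrable_def)
  have "integrable M (\<lambda>x. (norm b)\<^sup>2 * (norm (f x))\<^sup>2)"
    using f by (auto simp: square_integrable_def)
  moreover have "AE x in M. norm ((norm (f x \<bullet> b))\<^sup>2) \<le> norm ((norm b)\<^sup>2 * (norm (f x))\<^sup>2)"
  proof (rule AE_I2)
    fix x
    have "(norm (f x \<bullet> b))\<^sup>2 \<le> (norm b)\<^sup>2 * (norm (f x))\<^sup>2"
      unfolding power_mult_distrib[symmetric] real_norm_def
      by (intro power_mono) (auto intro: order_trans[OF Cauchy_Schwarz_ineq2] simp: mult.commute)
    then show "norm ((norm (f x \<bullet> b))\<^sup>2) \<le> norm ((norm b)\<^sup>2 * (norm (f x))\<^sup>2)" by simp
  qed
  ultimately show "integrable M (\<lambda>x. (norm (f x \<bullet> b))\<^sup>2)"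
    using f by (elim Bochner_Integration.integrable_bound) (auto simp: square_integrable_def)
qed

text \<open>Serves two bounded operations on a convergent sequence: multiplication by
  \<open>|x|^a\<close>, with \<open>c = R^a\<close>, and the inner product with a fixed vector
  \<open>b\<close>, with \<open>c = norm b\<close>.\<close>

lemma L2_tendsto_bound:
  fixes F' :: "nat \<Rightarrow> 'a \<Rightarrow> 'c::euclidean_space"
  assumes l: "L2_tendsto M F G" and [measurable]: "\<And>n. F n \<in> borel_measurable M" "G \<in> borel_measurable M"
    and b: "\<And>n. AE x in M. norm (F' n x - G' x) \<le> c * norm (F n x - G x)"
  shows "L2_tendsto M F' G'"
proof -
  have bd: "(\<integral>\<^sup>+x. ennreal ((norm (F' n x - G' x))\<^sup>2) \<partial>M)
      \<le> ennreal (c\<^sup>2) * (\<integral>\<^sup>+x. ennreal ((norm (F n x - G x))\<^sup>2) \<partial>M)" for n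
  proof -
    have "(\<integral>\<^sup>+x. ennreal ((norm (F' n x - G' x))\<^sup>2) \<partial>M)
      \<le> (\<integral>\<^sup>+x. ennreal (c\<^sup>2) * ennreal ((norm (F n x - G x))\<^sup>2) \<partial>M)"
      by (rule nn_integral_mono_AE, use b[of n] in eventually_elim)
        (auto simp flip: ennreal_mult power_mult_distrib intro!: power_mono)
    then show ?thesis by (simp add: nn_integral_cmult)
  qed
  have "(\<lambda>n. ennreal (c\<^sup>2) * (\<integral>\<^sup>+x. ennreal ((norm (F n x - G x))\<^sup>2) \<partial>M)) \<longlonglongrightarrow> ennreal (c\<^sup>2) * 0"
    using l unfolding L2_tendsto_def by (intro ennreal_tendsto_cmult) auto
  then have z: "(\<lambda>n. ennreal (c\<^sup>2) * (\<integral>\<^sup>+x. ennreal ((norm (F n x - G x))\<^sup>2) \<partial>M)) \<longlonglongrightarrow> 0"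
    by simp
  show ?thesis unfolding L2_tendsto_def
    by (rule tendsto_sandwich[OF _ _ tendsto_const z]) (use bd in auto)
qed

lemma square_integrable_inner:
  assumes f: "square_integrable M f" and g: "square_integrable M g"
  shows "integrable M (\<lambda>x. f x \<bullet> g x)"
proof (rule Bochner_Integration.integrable_bound)
  show "integrable M (\<lambda>x. (norm (f x))\<^sup>2 + (norm (g x))\<^sup>2)"
    using f g by (auto simp: square_integrable_def)
  show "(\<lambda>x. f x \<bullet> g x) \<in> borel_measurable M"
    using f g by (auto simp: square_integrable_def)
  have "\<bar>a \<bullet> b\<bar> \<le> (norm a)\<^sup>2 + (norm b)\<^sup>2" for a b :: 'b
    using Cauchy_Schwarz_ineq2[of a b] sum_squares_bound[of "norm a" "norm b"]
      mult_nonneg_nonneg[of "norm a" "norm b"] by simp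
  then show "AE x in M. norm (f x \<bullet> g x) \<le> norm ((norm (f x))\<^sup>2 + (norm (g x))\<^sup>2)" by simp
qed

text \<open>Reduces to the Cauchy-Schwarz inequality for nonnegative integrals, applied to the two
  norms; hence the passage through \<open>ennreal\<close>.\<close>

lemma integral_Cauchy_Schwarz:
  assumes f: "square_integrable M f" and g: "square_integrable M g"
  shows "\<bar>LINT x|M. f x \<bullet> g x\<bar> \<le> sqrt (LINT x|M. (norm (f x))\<^sup>2) * sqrt (LINT x|M. (norm (g x))\<^sup>2)"
proof -
  have [measurable]: "f \<in> borel_measurable M" "g \<in> borel_measurable M"
    using f g by (auto simp: square_integrable_def)
  have i: "integrable M (\<lambda>x. norm (f x) * norm (g x))"
    using square_integrable_inner[of M "\<lambda>x. norm (f x)" "\<lambda>x. norm (g x)"] f g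
    by (auto simp: square_integrable_def)
  have "ennreal ((LINT x|M. norm (f x) * norm (g x))\<^sup>2)
      = (\<integral>\<^sup>+x. ennreal (norm (f x)) * ennreal (norm (g x)) \<partial>M)\<^sup>2"
  proof -
    have "(\<integral>\<^sup>+x. ennreal (norm (f x)) * ennreal (norm (g x)) \<partial>M) = ennreal (LINT x|M. norm (f x) * norm (g x))"
      unfolding nn_integral_eq_integral[OF i, symmetric, simplified] by (simp only: ennreal_mult norm_ge_zero)
    then show ?thesis by (simp only: ennreal_power integral_nonneg_AE[OF AE_I2] mult_nonneg_nonneg norm_ge_zero)
  qed
  also have "\<dots> \<le> (\<integral>\<^sup>+x. (ennreal (norm (f x)))\<^sup>2 \<partial>M) * (\<integral>\<^sup>+x. (ennreal (norm (g x)))\<^sup>2 \<partial>M)"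
    by (rule Cauchy_Schwarz_nn_integral) auto
  also have "\<dots> = ennreal ((LINT x|M. (norm (f x))\<^sup>2) * (LINT x|M. (norm (g x))\<^sup>2))"
    by (simp only: ennreal_power norm_ge_zero square_integrable_nn_integral f g)
      (simp only: ennreal_mult integral_nonneg_AE[OF AE_I2] zero_le_power2)
  finally have "(LINT x|M. norm (f x) * norm (g x))\<^sup>2
      \<le> (LINT x|M. (norm (f x))\<^sup>2) * (LINT x|M. (norm (g x))\<^sup>2)"
    by (subst (asm) ennreal_le_iff) auto
  then have "(LINT x|M. norm (f x) * norm (g x))
      \<le> sqrt (LINT x|M. (norm (f x))\<^sup>2) * sqrt (LINT x|M. (norm (g x))\<^sup>2)"
    by (simp add: real_le_rsqrt real_sqrt_mult[symmetric])
  moreover have "\<bar>LINT x|M. f x \<bullet> g x\<bar> \<le> (LINT x|M. norm (f x) * norm (g x))"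
    by (rule order_trans[OF integral_abs_bound])
      (auto intro!: integral_mono i integrable_abs square_integrable_inner f g Cauchy_Schwarz_ineq2)
  ultimately show ?thesis by linarith
qed

text \<open>One index is enough: once the error \<open>F n - G\<close> has a finite square integral,
  \<open>G\<close> is the difference of \<open>F n\<close> and this error.\<close>

lemma L2_tendsto_square_integrable:
  assumes l: "L2_tendsto M F G" and F: "\<And>n. square_integrable M (F n)"
    and [measurable]: "G \<in> borel_measurable M"
  shows "square_integrable M G"
proof -
  from l have "\<forall>\<^sub>F n in sequentially. (\<integral>\<^sup>+x. ennreal ((norm (F n x - G x))\<^sup>2) \<partial>M) < 1"
    unfolding L2_tendsto_def by (rule order_tendstoD) simp
  then obtain n where n: "(\<integral>\<^sup>+x. ennreal ((norm (F n x - G x))\<^sup>2) \<partial>M) < 1"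
    by (auto simp: eventually_sequentially)
  have [measurable]: "F n \<in> borel_measurable M" using F by (auto simp: square_integrable_def)
  have "square_integrable M (\<lambda>x. F n x - G x)"
    unfolding square_integrable_iff using n by (auto intro: less_trans)
  from square_integrable_diff[OF F[of n] this] show ?thesis by simp
qed

lemma L2_tendsto_iff_integral:
  assumes "\<And>n. square_integrable M (F n)" and "square_integrable M G"
  shows "L2_tendsto M F G \<longleftrightarrow> (\<lambda>n. LINT x|M. (norm (F n x - G x))\<^sup>2) \<longlonglongrightarrow> 0"
proof -
  have "(\<integral>\<^sup>+x. ennreal ((norm (F n x - G x))\<^sup>2) \<partial>M) = ennreal (LINT x|M. (norm (F n x - G x))\<^sup>2)" for n
    by (intro square_integrable_nn_integral square_integrable_diff assms)
  then show ?thesis unfolding L2_tendsto_def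
    using tendsto_ennreal_iff[of "\<lambda>n. LINT x|M. (norm (F n x - G x))\<^sup>2" sequentially 0] by simp
qed

text \<open>The difference of the inner products splits into one term bilinear in the two errors and
  two terms linear in one of them. By Cauchy-Schwarz each is at most a product with a null
  factor.\<close>

lemma L2_tendsto_inner:
  assumes F: "\<And>n. square_integrable M (F n)" "square_integrable M F'" "L2_tendsto M F F'"
    and H: "\<And>n. square_integrable M (H n)" "square_integrable M H'" "L2_tendsto M H H'"
  shows "(\<lambda>n. LINT x|M. F n x \<bullet> H n x) \<longlonglongrightarrow> (LINT x|M. F' x \<bullet> H' x)"
proof -
  note d = square_integrable_diff and i = square_integrable_inner
  define nm :: "('a \<Rightarrow> 'b) \<Rightarrow> real" where "nm f = sqrt (LINT x|M. (norm (f x))\<^sup>2)" for f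
  have F0: "(\<lambda>n. nm (\<lambda>x. F n x - F' x)) \<longlonglongrightarrow> 0"
    using tendsto_real_sqrt[OF iffD1[OF L2_tendsto_iff_integral[OF F(1,2)] F(3)]] by (simp add: nm_def)
  have H0: "(\<lambda>n. nm (\<lambda>x. H n x - H' x)) \<longlonglongrightarrow> 0"
    using tendsto_real_sqrt[OF iffD1[OF L2_tendsto_iff_integral[OF H(1,2)] H(3)]] by (simp add: nm_def)
  have eq: "(LINT x|M. F n x \<bullet> H n x) - (LINT x|M. F' x \<bullet> H' x) =
      (LINT x|M. (F n x - F' x) \<bullet> (H n x - H' x)) + (LINT x|M. F' x \<bullet> (H n x - H' x))
      + (LINT x|M. (F n x - F' x) \<bullet> H' x)" for n
  proof -
    have "(LINT x|M. (F n x - F' x) \<bullet> (H n x - H' x)) + (LINT x|M. F' x \<bullet> (H n x - H' x))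
      + (LINT x|M. (F n x - F' x) \<bullet> H' x)
      = (LINT x|M. (F n x - F' x) \<bullet> (H n x - H' x) + F' x \<bullet> (H n x - H' x) + (F n x - F' x) \<bullet> H' x)"
      by (subst Bochner_Integration.integral_add, auto intro!: i d F H Bochner_Integration.integrable_add)+
    also have "\<dots> = (LINT x|M. F n x \<bullet> H n x - F' x \<bullet> H' x)"
      by (rule Bochner_Integration.integral_cong) (auto simp: inner_diff)
    also have "\<dots> = (LINT x|M. F n x \<bullet> H n x) - (LINT x|M. F' x \<bullet> H' x)"
      by (rule Bochner_Integration.integral_diff) (auto intro!: i F H)
    finally show ?thesis by simp
  qed
  have "(\<lambda>n. (LINT x|M. F n x \<bullet> H n x) - (LINT x|M. F' x \<bullet> H' x)) \<longlonglongrightarrow> 0"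
  proof (rule Lim_null_comparison)
    show "\<forall>\<^sub>F n in sequentially. norm ((LINT x|M. F n x \<bullet> H n x) - (LINT x|M. F' x \<bullet> H' x))
       \<le> nm (\<lambda>x. F n x - F' x) * nm (\<lambda>x. H n x - H' x) + nm F' * nm (\<lambda>x. H n x - H' x)
          + nm (\<lambda>x. F n x - F' x) * nm H'"
    proof (rule always_eventually, rule allI)
      fix n
      note c = integral_Cauchy_Schwarz[OF d[OF F(1)[of n] F(2)] d[OF H(1)[of n] H(2)]]
        integral_Cauchy_Schwarz[OF F(2) d[OF H(1)[of n] H(2)]]
        integral_Cauchy_Schwarz[OF d[OF F(1)[of n] F(2)] H(2)]
      show "norm ((LINT x|M. F n x \<bullet> H n x) - (LINT x|M. F' x \<bullet> H' x))
       \<le> nm (\<lambda>x. F n x - F' x) * nm (\<lambda>x. H n x - H' x) + nm F' * nm (\<lambda>x. H n x - H' x)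
          + nm (\<lambda>x. F n x - F' x) * nm H'"
        unfolding eq nm_def real_norm_def using c by linarith
    qed
    show "(\<lambda>n. nm (\<lambda>x. F n x - F' x) * nm (\<lambda>x. H n x - H' x) + nm F' * nm (\<lambda>x. H n x - H' x)
          + nm (\<lambda>x. F n x - F' x) * nm H') \<longlonglongrightarrow> 0"
      by (rule tendsto_eq_intros F0 H0 refl | simp)+
  qed
  then show ?thesis by (simp add: LIM_zero_iff)
qed

section \<open>Completeness of the space of square integrable functions\<close>

text \<open>The argument of Riesz and Fischer, with a weight. For consecutive members of a fast
  subsequence at distance \<open>d k x\<close>, the sum of \<open>2^k * (d k x)^2\<close> has a
  finite integral, so it is finite almost everywhere. Its terms are then bounded,
  \<open>d k x\<close> decays like \<open>2^(-k/2)\<close>, and the telescoping series converges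
  absolutely. The weight is what turns square summability into summability.\<close>

lemma L2_Cauchy_AE_subseq:
  fixes F :: "nat \<Rightarrow> 'a \<Rightarrow> 'b::euclidean_space"
  assumes [measurable]: "\<And>n. F n \<in> borel_measurable M"
    and C: "\<And>e. e > 0 \<Longrightarrow> \<exists>K. \<forall>m\<ge>K. \<forall>n\<ge>K. (\<integral>\<^sup>+x. ennreal ((norm (F m x - F n x))\<^sup>2) \<partial>M) < ennreal e"
  obtains r where "strict_mono (r::nat \<Rightarrow> nat)" "AE x in M. convergent (\<lambda>k. F (r k) x)"
proof -
  \<comment> \<open>The rate \<open>1/8\<close> absorbs the weight \<open>2^k\<close> used below and
    leaves a geometric series of ratio \<open>1/4\<close>.\<close>
  define P where "P k n \<longleftrightarrow> (\<forall>m\<ge>n. (\<integral>\<^sup>+x. ennreal ((norm (F m x - F n x))\<^sup>2) \<partial>M) < ennreal ((1/8)^k))" for k n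
  have ex: "\<exists>n>N. P k n" for k N
  proof -
    obtain K where K: "\<forall>m\<ge>K. \<forall>n\<ge>K. (\<integral>\<^sup>+x. ennreal ((norm (F m x - F n x))\<^sup>2) \<partial>M) < ennreal ((1/8)^k)"
      using C[of "(1/8)^k"] by auto
    then have "P k (max K (Suc N))" unfolding P_def by auto
    then show ?thesis by (intro exI[of _ "max K (Suc N)"]) auto
  qed
  have "\<exists>r. \<forall>k. P k (r k) \<and> r k < r (Suc k)"
  proof (rule dependent_nat_choice)
    show "\<exists>x. P 0 x" using ex by blast
    show "\<exists>y. P (Suc n) y \<and> x < y" for x n using ex[of x "Suc n"] by blast
  qed
  then obtain r where r: "\<And>k. P k (r k)" "\<And>k. r k < r (Suc k)" by blast
  have sm: "strict_mono r" using r(2) by (simp add: strict_mono_Suc_iff)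
  define d where "d k x = norm (F (r (Suc k)) x - F (r k) x)" for k x
  have [measurable]: "\<And>k. d k \<in> borel_measurable M" unfolding d_def by measurable
  have dk: "(\<integral>\<^sup>+x. ennreal ((d k x)\<^sup>2) \<partial>M) \<le> ennreal ((1/8)^k)" for k
    using r(1)[of k] r(2)[of k] by (auto simp: P_def d_def intro: less_imp_le)
  have "(\<integral>\<^sup>+x. (\<Sum>k. ennreal (2^k * (d k x)\<^sup>2)) \<partial>M) = (\<Sum>k. \<integral>\<^sup>+x. ennreal (2^k * (d k x)\<^sup>2) \<partial>M)"
    by (rule nn_integral_suminf) measurable
  also have "\<dots> \<le> (\<Sum>k. ennreal ((1/4)^k))"
  proof (intro suminf_le allI)
    fix k
    have "(\<integral>\<^sup>+x. ennreal (2^k * (d k x)\<^sup>2) \<partial>M) = ennreal (2^k) * (\<integral>\<^sup>+x. ennreal ((d k x)\<^sup>2) \<partial>M)"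
      by (simp add: ennreal_mult nn_integral_cmult)
    also have "\<dots> \<le> ennreal (2^k) * ennreal ((1/8)^k)" by (intro mult_left_mono dk) simp
    also have "\<dots> = ennreal ((1/4)^k)"
      by (simp add: ennreal_mult[symmetric] power_mult_distrib[symmetric])
    finally show "(\<integral>\<^sup>+x. ennreal (2^k * (d k x)\<^sup>2) \<partial>M) \<le> ennreal ((1/4)^k)" .
  qed auto
  also have "\<dots> < \<infinity>"
    by (subst suminf_ennreal2) (auto intro: summable_geometric)
  finally have fin: "(\<integral>\<^sup>+x. (\<Sum>k. ennreal (2^k * (d k x)\<^sup>2)) \<partial>M) \<noteq> \<infinity>" by simp
  have "AE x in M. (\<Sum>k. ennreal (2^k * (d k x)\<^sup>2)) \<noteq> \<infinity>"
    by (rule nn_integral_noteq_infinite[OF _ fin]) measurable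
  then have "AE x in M. convergent (\<lambda>k. F (r k) x)"
  proof eventually_elim
    fix x assume a: "(\<Sum>k. ennreal (2^k * (d k x)\<^sup>2)) \<noteq> \<infinity>"
    have s: "summable (\<lambda>k. 2^k * (d k x)\<^sup>2)"
      by (rule summable_suminf_not_top) (use a in auto)
    then obtain C where C: "\<And>k. norm (2^k * (d k x)\<^sup>2) \<le> C"
      using summable_imp_Bseq unfolding Bseq_def by blast
    have "d k x \<le> sqrt C * (sqrt (1/2))^k" for k
    proof -
      have "2^k * (d k x)\<^sup>2 \<le> C" using C[of k] by simp
      then have "(1/2)^k * (2^k * (d k x)\<^sup>2) \<le> (1/2)^k * C" by (intro mult_left_mono) auto
      moreover have "(1/2)^k * (2^k * (d k x)\<^sup>2) = (d k x)\<^sup>2"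
        by (simp add: mult.assoc[symmetric] power_mult_distrib[symmetric])
      ultimately have "(d k x)\<^sup>2 \<le> C * (1/2)^k" by (simp add: mult.commute)
      then have "sqrt ((d k x)\<^sup>2) \<le> sqrt (C * (1/2)^k)" by (rule real_sqrt_le_mono)
      then show ?thesis by (simp add: d_def real_sqrt_mult real_sqrt_power)
    qed
    moreover have "summable (\<lambda>k. sqrt C * (sqrt (1/2))^k)"
      by (intro summable_mult summable_geometric) (simp add: real_sqrt_divide)
    moreover have "norm (d k x) = d k x" for k by (simp add: d_def)
    ultimately have "summable (\<lambda>k. d k x)"
      using summable_comparison_test'[of "\<lambda>k. sqrt C * (sqrt (1/2))^k" 0 "\<lambda>k. d k x"] by metis
    then have "summable (\<lambda>k. F (r (Suc k)) x - F (r k) x)"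
      unfolding d_def by (rule summable_norm_cancel)
    then have "(\<lambda>k. \<Sum>i<k. F (r (Suc i)) x - F (r i) x) \<longlonglongrightarrow> (\<Sum>k. F (r (Suc k)) x - F (r k) x)"
      by (rule summable_LIMSEQ)
    then have "(\<lambda>k. F (r k) x - F (r 0) x) \<longlonglongrightarrow> (\<Sum>k. F (r (Suc k)) x - F (r k) x)"
      by (simp add: sum_lessThan_telescope[of "\<lambda>i. F (r i) x"])
    from tendsto_add[OF this tendsto_const[of "F (r 0) x"]]
    show "convergent (\<lambda>k. F (r k) x)" by (auto simp: convergent_def)
  qed
  with sm show ?thesis by (rule that)
qed

text \<open>Fatou's lemma, letting the second index of the Cauchy condition tend to infinity along \<open>r\<close>.\<close>

lemma L2_tendsto_if_Cauchy_AE: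
  fixes F :: "nat \<Rightarrow> 'a \<Rightarrow> 'b::euclidean_space"
  assumes [measurable]: "\<And>n. F n \<in> borel_measurable M" "G \<in> borel_measurable M"
    and C: "\<And>e. e > 0 \<Longrightarrow> \<exists>K. \<forall>m\<ge>K. \<forall>n\<ge>K. (\<integral>\<^sup>+x. ennreal ((norm (F m x - F n x))\<^sup>2) \<partial>M) < ennreal e"
    and r: "strict_mono r" and ae: "AE x in M. (\<lambda>k. F (r k) x) \<longlonglongrightarrow> G x"
  shows "L2_tendsto M F G"
  unfolding L2_tendsto_def
proof (rule order_tendstoI)
  fix a :: ennreal assume "a < 0" then show "\<forall>\<^sub>F n in sequentially. a < (\<integral>\<^sup>+x. ennreal ((norm (F n x - G x))\<^sup>2) \<partial>M)"
    by simp
next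
  fix a :: ennreal assume "0 < a"
  \<comment> \<open>\<open>a\<close> may be infinite, whereas the Cauchy condition is stated for a
    real bound; \<open>c\<close> is a finite positive value below \<open>a\<close>.\<close>
  then obtain c where c: "0 < c" "c < a" using dense by blast
  define e where "e = enn2real c"
  have "c < top" using c(2) by (rule less_le_trans) simp
  with c(1) have "c = ennreal e" "0 < e"
    by (auto simp: e_def enn2real_positive_iff)
  then have e: "0 < e" "ennreal e < a" using c by auto
  obtain K where K: "\<forall>m\<ge>K. \<forall>n\<ge>K. (\<integral>\<^sup>+x. ennreal ((norm (F m x - F n x))\<^sup>2) \<partial>M) < ennreal e"
    using C[OF e(1)] by auto
  have "(\<integral>\<^sup>+x. ennreal ((norm (F n x - G x))\<^sup>2) \<partial>M) < a" if n: "n \<ge> K" for n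
  proof -
    have "(\<integral>\<^sup>+x. ennreal ((norm (F n x - G x))\<^sup>2) \<partial>M)
        = (\<integral>\<^sup>+x. liminf (\<lambda>k. ennreal ((norm (F n x - F (r k) x))\<^sup>2)) \<partial>M)"
    proof (rule nn_integral_cong_AE, use ae in eventually_elim)
      fix x assume "(\<lambda>k. F (r k) x) \<longlonglongrightarrow> G x"
      then have "(\<lambda>k. ennreal ((norm (F n x - F (r k) x))\<^sup>2)) \<longlonglongrightarrow> ennreal ((norm (F n x - G x))\<^sup>2)"
        by (intro tendsto_intros)
      then show "ennreal ((norm (F n x - G x))\<^sup>2) = liminf (\<lambda>k. ennreal ((norm (F n x - F (r k) x))\<^sup>2))"
        using lim_imp_Liminf[OF trivial_limit_sequentially] by metis
    qed
    also have "\<dots> \<le> liminf (\<lambda>k. \<integral>\<^sup>+x. ennreal ((norm (F n x - F (r k) x))\<^sup>2) \<partial>M)"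
      by (rule nn_integral_liminf) measurable
    also have "\<dots> \<le> liminf (\<lambda>k. ennreal e)"
    proof (rule Liminf_mono, rule eventually_sequentiallyI[of K])
      fix k assume "k \<ge> K"
      then have "r k \<ge> K" using seq_suble[OF r, of k] by linarith
      then show "(\<integral>\<^sup>+x. ennreal ((norm (F n x - F (r k) x))\<^sup>2) \<partial>M) \<le> ennreal e"
        using K n by (auto intro: less_imp_le)
    qed
    also have "\<dots> = ennreal e" by (simp add: Liminf_const)
    finally show ?thesis using e by simp
  qed
  then show "\<forall>\<^sub>F n in sequentially. (\<integral>\<^sup>+x. ennreal ((norm (F n x - G x))\<^sup>2) \<partial>M) < a"
    by (auto simp: eventually_sequentially)
qed

lemma L2_complete:
  fixes F :: "nat \<Rightarrow> 'a \<Rightarrow> 'b::euclidean_space"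
  assumes [measurable]: "\<And>n. F n \<in> borel_measurable M"
    and C: "\<And>e. e > 0 \<Longrightarrow> \<exists>K. \<forall>m\<ge>K. \<forall>n\<ge>K. (\<integral>\<^sup>+x. ennreal ((norm (F m x - F n x))\<^sup>2) \<partial>M) < ennreal e"
  obtains G where "G \<in> borel_measurable M" "L2_tendsto M F G"
proof -
  obtain r where r: "strict_mono (r::nat \<Rightarrow> nat)" "AE x in M. convergent (\<lambda>k. F (r k) x)"
    using L2_Cauchy_AE_subseq[of F M] C by auto
  \<comment> \<open>Where the subsequence diverges, \<open>lim\<close> returns an unspecified value;
    this happens on a null set only and does not disturb measurability.\<close>
  define G where "G x = lim (\<lambda>k. F (r k) x)" for x
  have G: "G \<in> borel_measurable M" unfolding G_def by measurable
  have "AE x in M. (\<lambda>k. F (r k) x) \<longlonglongrightarrow> G x"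
    using r(2) by eventually_elim (simp add: G_def convergent_LIMSEQ_iff)
  from L2_tendsto_if_Cauchy_AE[OF assms(1) G C r(1) this] G that show ?thesis by blast
qed

text \<open>Convergence in L2 says that the squared errors tend to 0 in L1, and an L1 null sequence
  has a subsequence that tends to 0 almost everywhere.\<close>

lemma L2_tendsto_AE_subseq:
  assumes F: "\<And>n. square_integrable M (F n)" and G: "square_integrable M G"
    and l: "L2_tendsto M F G"
  obtains r where "strict_mono (r::nat \<Rightarrow> nat)" "AE x in M. (\<lambda>k. F (r k) x) \<longlonglongrightarrow> G x"
proof -
  have "\<exists>r::nat\<Rightarrow>nat. strict_mono r \<and> (AE x in M. (\<lambda>n. (norm (F (r n) x - G x))\<^sup>2) \<longlonglongrightarrow> 0)"
  proof (rule tendsto_L1_AE_subseq)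
    show "integrable M (\<lambda>x. (norm (F n x - G x))\<^sup>2)" for n
      using square_integrable_diff[OF F[of n] G] by (simp add: square_integrable_def)
    show "(\<lambda>n. LINT x|M. norm ((norm (F n x - G x))\<^sup>2)) \<longlonglongrightarrow> 0"
      using L2_tendsto_iff_integral[OF F G] l by simp
  qed
  then obtain r :: "nat \<Rightarrow> nat" where r: "strict_mono r" "AE x in M. (\<lambda>n. (norm (F (r n) x - G x))\<^sup>2) \<longlonglongrightarrow> 0"
    by blast
  from r(2) have "AE x in M. (\<lambda>k. F (r k) x) \<longlonglongrightarrow> G x"
  proof eventually_elim
    fix x assume "(\<lambda>n. (norm (F (r n) x - G x))\<^sup>2) \<longlonglongrightarrow> 0"
    from tendsto_real_sqrt[OF this] show "(\<lambda>k. F (r k) x) \<longlonglongrightarrow> G x"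
      by (simp add: LIM_zero_iff tendsto_norm_zero_iff)
  qed
  with r(1) show ?thesis by (rule that)
qed

lemma square_integrable_bound:
  fixes f :: "'a \<Rightarrow> 'b::euclidean_space" and g :: "'a \<Rightarrow> 'c::euclidean_space"
  assumes f: "square_integrable M f" and g: "g \<in> borel_measurable M"
    and b: "AE x in M. norm (g x) \<le> c * norm (f x)"
  shows "square_integrable M g"
  unfolding square_integrable_def
proof
  show "integrable M (\<lambda>x. (norm (g x))\<^sup>2)"
  proof (rule Bochner_Integration.integrable_bound)
    show "integrable M (\<lambda>x. c\<^sup>2 * (norm (f x))\<^sup>2)" using f by (auto simp: square_integrable_def)
    show "(\<lambda>x. (norm (g x))\<^sup>2) \<in> borel_measurable M" using g by measurable
    show "AE x in M. norm ((norm (g x))\<^sup>2) \<le> norm (c\<^sup>2 * (norm (f x))\<^sup>2)"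
      using b by eventually_elim (auto simp flip: power_mult_distrib intro!: power_mono)
  qed
qed (rule g)

lemma square_integrable_scaleR:
  assumes f: "square_integrable M f" and g: "square_integrable M g"
  shows "integrable M (\<lambda>x. f x *\<^sub>R g x)"
proof (rule Bochner_Integration.integrable_bound)
  show "integrable M (\<lambda>x. (norm (f x))\<^sup>2 + (norm (g x))\<^sup>2)"
    using f g by (auto simp: square_integrable_def)
  show "(\<lambda>x. f x *\<^sub>R g x) \<in> borel_measurable M"
    using f g by (auto simp: square_integrable_def)
  have "norm (a *\<^sub>R b) \<le> norm ((norm a)\<^sup>2 + (norm b)\<^sup>2)" for a :: real and b :: 'b
  proof -
    have "2 * (\<bar>a\<bar> * norm b) \<le> (norm a)\<^sup>2 + (norm b)\<^sup>2"
      using sum_squares_bound[of "\<bar>a\<bar>" "norm b"] by simp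
    moreover have "0 \<le> \<bar>a\<bar> * norm b" by simp
    ultimately have "\<bar>a\<bar> * norm b \<le> (norm a)\<^sup>2 + (norm b)\<^sup>2" by linarith
    then show ?thesis by simp
  qed
  then show "AE x in M. norm (f x *\<^sub>R g x) \<le> norm ((norm (f x))\<^sup>2 + (norm (g x))\<^sup>2)" by simp
qed

lemma square_integrable_imp_integrable:
  assumes "finite_measure M" and f: "square_integrable M f"
  shows "integrable M f"
proof (rule Bochner_Integration.integrable_bound)
  interpret finite_measure M by fact
  show "integrable M (\<lambda>x. 1 + (norm (f x))\<^sup>2)" using f by (auto simp: square_integrable_def)
  show "f \<in> borel_measurable M" using f by (auto simp: square_integrable_def)
  have "norm (f x) \<le> 1 + (norm (f x))\<^sup>2" for x
  proof -
    have "2 * norm (f x) \<le> 1 + (norm (f x))\<^sup>2" using sum_squares_bound[of 1 "norm (f x)"] by simp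
    then show ?thesis using norm_ge_zero[of "f x"] by linarith
  qed
  then show "AE x in M. norm (f x) \<le> norm (1 + (norm (f x))\<^sup>2)" by simp
qed

text \<open>Translates the Cauchy condition of \<open>represents\<close>, a statement about a
  real-valued norm \<open>q\<close>, into the one of the completeness lemmas, which speaks of
  squared distances in \<open>ennreal\<close>.\<close>

lemma L2_Cauchy_transfer:
  fixes q :: "nat \<Rightarrow> nat \<Rightarrow> real"
  assumes C: "\<And>e. e > 0 \<Longrightarrow> \<exists>K. \<forall>m\<ge>K. \<forall>n\<ge>K. q m n < e" and q: "\<And>m n. 0 \<le> q m n"
    and I: "\<And>m n. I m n \<le> ennreal (c * (q m n)\<^sup>2)" and c: "c \<ge> 0" and e: "e > 0"
  shows "\<exists>K. \<forall>m\<ge>K. \<forall>n\<ge>K. I m n < ennreal e"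
proof -
  \<comment> \<open>The denominator is \<open>c + 1\<close> because \<open>c\<close> may be
    0.\<close>
  have "sqrt (e / (c + 1)) > 0" using e c by simp
  then obtain K where K: "\<forall>m\<ge>K. \<forall>n\<ge>K. q m n < sqrt (e / (c + 1))" using C by blast
  have "I m n < ennreal e" if "m \<ge> K" "n \<ge> K" for m n
  proof -
    have "(q m n)\<^sup>2 < (sqrt (e / (c + 1)))\<^sup>2"
      using K that q by (intro power_strict_mono) auto
    then have "(c + 1) * (q m n)\<^sup>2 < e" using c e by (simp add: field_simps)
    moreover have "c * (q m n)\<^sup>2 \<le> (c + 1) * (q m n)\<^sup>2" by (simp add: algebra_simps)
    ultimately show ?thesis using I[of m n] e by (intro le_less_trans[OF I]) (auto intro: ennreal_lessI)
  qed
  then show ?thesis by blast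
qed

section \<open>Polar coordinates\<close>

text \<open>The mass of a set of unit vectors is the volume of the cone over it in the unit ball.
  The total mass is thus the volume of the unit ball, not the area of the sphere; the missing factor
  \<open>N\<close> sits in \<open>radial_measure\<close>.\<close>

definition direction_measure :: "'a::euclidean_space measure"
  where "direction_measure = distr (restrict_space lborel (ball 0 1)) borel sgn"

text \<open>Normalised so that \<open>{..<r}\<close> has mass \<open>r ^ N\<close> for
  \<open>r \<ge> 0\<close>, the factor by which the volume of the unit ball scales.\<close>

definition radial_measure :: "nat \<Rightarrow> real measure"
  where "radial_measure N = density lborel (\<lambda>r. ennreal (real N * r ^ (N - 1) * indicator {0<..} r))"

lemma sets_direction_measure [simp, measurable_cong]: "sets direction_measure = sets borel"
  and space_direction_measure [simp]: "space direction_measure = UNIV"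
  by (auto simp: direction_measure_def)

lemma sets_radial_measure [simp, measurable_cong]: "sets (radial_measure N) = sets borel"
  and space_radial_measure [simp]: "space (radial_measure N) = UNIV"
  by (auto simp: radial_measure_def)

lemma measurable_sgn_ball:
  "(sgn :: 'a::euclidean_space \<Rightarrow> 'a) \<in> measurable (restrict_space lborel (ball 0 1)) borel"
  by (intro measurable_restrict_space1) (auto simp: sgn_div_norm)

lemma emeasure_direction_measure:
  assumes "S \<in> sets borel"
  shows "emeasure direction_measure S = emeasure lborel {x::'a::euclidean_space. norm x < 1 \<and> sgn x \<in> S}"
proof -
  have "emeasure direction_measure S =
      emeasure (restrict_space lborel (ball 0 1)) (sgn -` S \<inter> ball (0::'a) 1)"
    using assms measurable_sgn_ball unfolding direction_measure_def
    by (subst emeasure_distr) (auto simp: space_restrict_space)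
  also have "\<dots> = emeasure lborel (sgn -` S \<inter> ball (0::'a) 1)"
    by (rule emeasure_restrict_space) auto
  also have "sgn -` S \<inter> ball (0::'a) 1 = {x. norm x < 1 \<and> sgn x \<in> S}" by auto
  finally show ?thesis .
qed

lemma emeasure_direction_measure_UNIV:
  "emeasure (direction_measure :: 'a::euclidean_space measure) UNIV = emeasure lborel (ball (0::'a) 1)"
  by (simp add: emeasure_direction_measure ball_def)

lemma finite_direction_measure: "finite_measure (direction_measure :: 'a::euclidean_space measure)"
  by (rule finite_measureI) (simp add: emeasure_direction_measure_UNIV less_imp_neq[OF emeasure_lborel_ball_finite, unfolded infinity_ennreal_def])

interpretation direction: finite_measure "direction_measure :: 'a::euclidean_space measure"
  by (rule finite_direction_measure)

lemma measure_direction_measure_UNIV: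
  "measure (direction_measure :: 'a::euclidean_space measure) UNIV = measure lebesgue (ball (0::'a) 1)"
  by (simp add: measure_def emeasure_direction_measure_UNIV)

text \<open>The only exceptional direction is \<open>sgn 0 = 0\<close>, which comes from the centre
  of the ball, a null set.\<close>

lemma AE_direction_norm: "AE s in (direction_measure :: 'a::euclidean_space measure). norm s = 1"
proof -
  have "AE x in restrict_space lborel (ball (0::'a) 1). norm (sgn x) = 1"
    using AE_lborel_singleton[of "0::'a"] by (subst AE_restrict_space_iff) (auto simp: norm_sgn)
  then show ?thesis unfolding direction_measure_def
    by (subst AE_distr_iff) (auto intro: measurable_sgn_ball)
qed

lemma sigma_finite_radial_measure: "sigma_finite_measure (radial_measure N)"
  unfolding radial_measure_def
  by (subst sigma_finite_measure.sigma_finite_iff_density_finite[OF sigma_finite_lborel]) auto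

lemma emeasure_radial_measure_lessThan:
  assumes r: "0 \<le> r" and N: "0 < N"
  shows "emeasure (radial_measure N) {..<r} = ennreal (r ^ N)"
proof -
  have "emeasure (radial_measure N) {..<r}
      = (\<integral>\<^sup>+t. ennreal (real N * t ^ (N - 1) * indicator {0<..} t) * indicator {..<r} t \<partial>lborel)"
    unfolding radial_measure_def by (subst emeasure_density) auto
  also have "\<dots> = (\<integral>\<^sup>+t. ennreal (real N * t ^ (N - 1)) * indicator {0..r} t \<partial>lborel)"
    by (rule nn_integral_cong_AE, use AE_lborel_singleton[of 0] AE_lborel_singleton[of r] in eventually_elim)
      (auto simp: indicator_def)
  also have "\<dots> = ennreal (r ^ N - 0 ^ N)"
    by (rule nn_integral_FTC_Icc) (auto intro!: derivative_eq_intros r)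
  finally show ?thesis using N by (simp add: zero_power)
qed

lemma emeasure_lborel_scaleR:
  assumes c: "0 < c" and T [measurable]: "T \<in> sets (borel :: 'a::euclidean_space measure)"
  shows "emeasure lborel T = ennreal (c ^ DIM('a)) * emeasure lborel {x. c *\<^sub>R x \<in> T}"
proof -
  have "emeasure lborel T = emeasure (density (distr lborel borel (\<lambda>x::'a. 0 + c *\<^sub>R x)) (\<lambda>_. ennreal (\<bar>c\<bar>^DIM('a)))) T"
    using c lborel_affine[of c "0::'a"] by (simp add: ennreal_power)
  also have "\<dots> = ennreal (c ^ DIM('a)) * emeasure (distr lborel borel (\<lambda>x::'a. c *\<^sub>R x)) T"
    using c by (subst emeasure_density) (auto simp: nn_integral_cmult_indicator)
  also have "emeasure (distr lborel borel (\<lambda>x::'a. c *\<^sub>R x)) T = emeasure lborel {x. c *\<^sub>R x \<in> T}"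
    by (subst emeasure_distr) (auto simp: vimage_def)
  finally show ?thesis .
qed

text \<open>For fixed \<open>S\<close> both sides are measures in \<open>C\<close>. The half-lines
  \<open>{..<r}\<close> are stable under intersection and generate the Borel sets, and on them the
  claim is the scaling of volume by \<open>r ^ N\<close>.\<close>

lemma emeasure_radial_sector:
  fixes S :: "'a::euclidean_space set"
  assumes S [measurable]: "S \<in> sets borel" and C: "C \<in> sets borel"
  shows "emeasure lborel {x. norm x \<in> C \<and> sgn x \<in> S}
       = emeasure direction_measure S * emeasure (radial_measure DIM('a)) C"
proof -
  have sgn [measurable]: "(sgn :: 'a \<Rightarrow> 'a) \<in> borel_measurable borel" by (simp add: sgn_div_norm)
  define \<mu> where "\<mu> = distr (restrict_space lborel {x::'a. sgn x \<in> S}) borel norm"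
  define \<nu> where "\<nu> = scale_measure (emeasure direction_measure S) (radial_measure DIM('a))"
  have mu: "emeasure \<mu> D = emeasure lborel {x. norm x \<in> D \<and> sgn x \<in> S}" if D: "D \<in> sets borel" for D
  proof -
    have [measurable]: "D \<in> sets borel" by (rule D)
    have "emeasure \<mu> D = emeasure (restrict_space lborel {x::'a. sgn x \<in> S}) (norm -` D \<inter> {x. sgn x \<in> S})"
      unfolding \<mu>_def
      by (subst emeasure_distr) (auto simp: space_restrict_space D intro!: measurable_restrict_space1)
    also have "\<dots> = emeasure lborel (norm -` D \<inter> {x. sgn x \<in> S})"
      by (rule emeasure_restrict_space) auto
    also have "norm -` D \<inter> {x. sgn x \<in> S} = {x. norm x \<in> D \<and> sgn x \<in> S}" by auto
    finally show ?thesis .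
  qed
  have nu: "emeasure \<nu> D = emeasure direction_measure S * emeasure (radial_measure DIM('a)) D" for D
    by (simp add: \<nu>_def)
  have less: "emeasure \<mu> {..<r} = emeasure \<nu> {..<r}" for r
  proof (cases "r > 0")
    case True
    have "emeasure lborel {x. norm x \<in> {..<r} \<and> sgn x \<in> S}
        = ennreal (r ^ DIM('a)) * emeasure lborel {x. r *\<^sub>R x \<in> {x. norm x \<in> {..<r} \<and> sgn x \<in> S}}"
      by (rule emeasure_lborel_scaleR[OF True]) measurable
    also have "{x. r *\<^sub>R x \<in> {x. norm x \<in> {..<r} \<and> sgn x \<in> S}} = {x. norm x < 1 \<and> sgn x \<in> S}"
      using True by (auto simp: sgn_scaleR)
    finally show ?thesis using True
      by (simp add: mu nu emeasure_direction_measure emeasure_radial_measure_lessThan mult.commute)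
  next
    case False
    then have e: "{x::'a. norm x \<in> {..<r} \<and> sgn x \<in> S} = {}"
      by (auto dest: le_less_trans[OF norm_ge_zero])
    have "emeasure (radial_measure DIM('a)) {..<r} \<le> emeasure (radial_measure DIM('a)) {..<0}"
      using False by (intro emeasure_mono) auto
    then have "emeasure (radial_measure DIM('a)) {..<r} = 0"
      by (simp add: emeasure_radial_measure_lessThan zero_power)
    then show ?thesis unfolding nu mu[OF lessThan_borel] e by simp
  qed
  have "\<mu> = \<nu>"
  proof (rule measure_eqI_generator_eq[where E="range lessThan" and \<Omega>=UNIV and A="\<lambda>n. {..<real n}"])
    show "Int_stable (range lessThan :: real set set)" 
    proof (rule Int_stableI_image)
      show "\<exists>c\<in>UNIV. {..<a} \<inter> {..<b} = {..<c}" for a b :: real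
        by (intro bexI[of _ "min a b"]) auto
    qed
    show "sets \<mu> = sigma_sets UNIV (range lessThan)" "sets \<nu> = sigma_sets UNIV (range lessThan)"
      by (simp_all add: \<mu>_def \<nu>_def borel_Iio)
    show "(\<Union>i. {..<real i}) = UNIV" by (auto intro: reals_Archimedean2)
    show "emeasure \<mu> {..<real i} \<noteq> \<infinity>" for i
      unfolding less nu by (simp add: emeasure_radial_measure_lessThan ennreal_mult_eq_top_iff
          direction.emeasure_finite)
  qed (auto simp: less)
  with mu[OF C] nu show ?thesis by metis
qed

text \<open>By the sector formula, the image of \<open>lborel\<close> under
  \<open>x \<mapsto> (sgn x, norm x)\<close> agrees with the product measure on rectangles. The map
  \<open>(s, r) \<mapsto> r s\<close> undoes this one at every point, the origin included.\<close>

theorem lborel_polar: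
  "(lborel :: 'a::euclidean_space measure)
     = distr (direction_measure \<Otimes>\<^sub>M radial_measure DIM('a)) borel (\<lambda>(s, r). r *\<^sub>R s)"
proof -
  have sgn [measurable]: "(sgn :: 'a \<Rightarrow> 'a) \<in> borel_measurable borel" by (simp add: sgn_div_norm)
  have "direction_measure \<Otimes>\<^sub>M radial_measure DIM('a)
      = distr lborel (borel \<Otimes>\<^sub>M borel) (\<lambda>x::'a. (sgn x, norm x))"
  proof (rule pair_measure_eqI)
    show "sigma_finite_measure (direction_measure :: 'a measure)" by unfold_locales
    show "sigma_finite_measure (radial_measure DIM('a))" by (rule sigma_finite_radial_measure)
    show "sets (direction_measure \<Otimes>\<^sub>M radial_measure DIM('a))
        = sets (distr lborel (borel \<Otimes>\<^sub>M borel) (\<lambda>x::'a. (sgn x, norm x)))"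
      by (simp cong: sets_pair_measure_cong)
    fix A :: "'a set" and B :: "real set"
    assume "A \<in> sets direction_measure" "B \<in> sets (radial_measure DIM('a))"
    then show "emeasure direction_measure A * emeasure (radial_measure DIM('a)) B
        = emeasure (distr lborel (borel \<Otimes>\<^sub>M borel) (\<lambda>x::'a. (sgn x, norm x))) (A \<times> B)"
      by (subst emeasure_distr) (auto simp: emeasure_radial_sector[symmetric] intro!: arg_cong[where f="emeasure lborel"])
  qed
  then have "distr (direction_measure \<Otimes>\<^sub>M radial_measure DIM('a)) borel (\<lambda>(s, r). r *\<^sub>R s)
      = distr lborel borel ((\<lambda>(s, r). r *\<^sub>R s) \<circ> (\<lambda>x::'a. (sgn x, norm x)))"
    by (simp add: distr_distr)
  also have "\<dots> = distr lborel lborel (\<lambda>x. x)"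
    by (rule distr_cong) (auto simp: sgn_div_norm field_simps)
  finally show ?thesis by (simp add: distr_id)
qed

interpretation polar: pair_sigma_finite "direction_measure :: 'a::euclidean_space measure" "radial_measure N"
  by (intro pair_sigma_finite.intro sigma_finite_radial_measure) unfold_locales

lemma nn_integral_polar:
  fixes f :: "'a::euclidean_space \<Rightarrow> ennreal"
  assumes [measurable]: "f \<in> borel_measurable borel"
  shows "(\<integral>\<^sup>+x. f x \<partial>lborel)
       = (\<integral>\<^sup>+s. \<integral>\<^sup>+r. ennreal (real DIM('a) * r ^ (DIM('a) - 1) * indicator {0<..} r) * f (r *\<^sub>R s) \<partial>lborel \<partial>direction_measure)"
proof -
  have "(\<integral>\<^sup>+x. f x \<partial>lborel) = (\<integral>\<^sup>+p. f (snd p *\<^sub>R fst p) \<partial>(direction_measure \<Otimes>\<^sub>M radial_measure DIM('a)))"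
    by (subst lborel_polar, subst nn_integral_distr) (auto simp: case_prod_beta)
  also have "\<dots> = (\<integral>\<^sup>+s. \<integral>\<^sup>+r. f (r *\<^sub>R s) \<partial>radial_measure DIM('a) \<partial>direction_measure)"
    by (subst polar.M2.nn_integral_fst[symmetric]) auto
  also have "\<dots> = (\<integral>\<^sup>+s. \<integral>\<^sup>+r. ennreal (real DIM('a) * r ^ (DIM('a) - 1) * indicator {0<..} r) * f (r *\<^sub>R s) \<partial>lborel \<partial>direction_measure)"
    unfolding radial_measure_def by (subst nn_integral_density) auto
  finally show ?thesis .
qed

lemma integral_polar:
  fixes f :: "'a::euclidean_space \<Rightarrow> real"
  assumes f: "integrable lborel f"
  shows "(LINT x|lborel. f x)
       = (LINT s|direction_measure. LINT r|lborel. real DIM('a) * r ^ (DIM('a) - 1) * indicator {0<..} r * f (r *\<^sub>R s))"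
proof -
  have [measurable]: "f \<in> borel_measurable borel" using borel_measurable_integrable[OF f] by simp
  have i: "integrable (direction_measure \<Otimes>\<^sub>M radial_measure DIM('a)) (\<lambda>p. f (snd p *\<^sub>R fst p))"
    using f by (subst (asm) lborel_polar, subst (asm) integrable_distr_eq) (auto simp: case_prod_beta)
  have "(LINT x|lborel. f x) = (LINT p|(direction_measure \<Otimes>\<^sub>M radial_measure DIM('a)). f (snd p *\<^sub>R fst p))"
    by (subst lborel_polar, subst integral_distr) (auto simp: case_prod_beta)
  also have "\<dots> = (LINT s|direction_measure. LINT r|radial_measure DIM('a). f (r *\<^sub>R s))"
    using polar.integral_fst'[OF i] by simp
  also have "\<dots> = (LINT s|direction_measure. LINT r|lborel. real DIM('a) * r ^ (DIM('a) - 1) * indicator {0<..} r * f (r *\<^sub>R s))"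
    unfolding radial_measure_def by (subst integral_density) (auto simp: indicator_def)
  finally show ?thesis .
qed

section \<open>Compactly supported functions of class \<open>C\<^sup>1\<close>\<close>

lemma GDERIV_unique:
  assumes "GDERIV f x :> D" "GDERIV f x :> E"
  shows "D = E"
proof -
  have "(\<lambda>h. h \<bullet> D) = (\<lambda>h. h \<bullet> E)"
    using assms unfolding gderiv_def by (rule has_derivative_unique)
  then have "(D - E) \<bullet> D = (D - E) \<bullet> E" by metis
  then have "(D - E) \<bullet> (D - E) = 0" by (simp add: inner_diff_right)
  then show ?thesis by simp
qed

lemma grad_eqI: "GDERIV f x :> D \<Longrightarrow> grad f x = D"
  unfolding grad_def by (rule the_equality) (auto intro: GDERIV_unique)

text \<open>Riesz representation of the derivative in coordinates: the components of the gradient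
  are the values of the derivative on the basis. It justifies the \<open>THE\<close> in
  \<open>grad\<close>.\<close>

lemma GDERIV_grad:
  fixes f :: "'a::euclidean_space \<Rightarrow> real"
  assumes "f differentiable (at x)"
  shows "GDERIV f x :> grad f x"
proof -
  obtain D where D: "(f has_derivative D) (at x)" using assms by (auto simp: differentiable_def)
  then interpret linear D by (rule has_derivative_linear)
  have "D h = h \<bullet> (\<Sum>b\<in>Basis. D b *\<^sub>R b)" for h
  proof -
    have "D h = D (\<Sum>b\<in>Basis. (h \<bullet> b) *\<^sub>R b)" by (simp add: euclidean_representation)
    also have "\<dots> = h \<bullet> (\<Sum>b\<in>Basis. D b *\<^sub>R b)"
      by (simp add: sum scaleR inner_sum_right mult.commute)
    finally show ?thesis .
  qed
  then have "D = (\<lambda>h. h \<bullet> (\<Sum>b\<in>Basis. D b *\<^sub>R b))" by blast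
  with D have "GDERIV f x :> (\<Sum>b\<in>Basis. D b *\<^sub>R b)" unfolding gderiv_def by metis
  then show ?thesis using grad_eqI by metis
qed

lemma GDERIV_imp_differentiable: "GDERIV f x :> D \<Longrightarrow> f differentiable (at x)"
  by (auto simp: gderiv_def differentiable_def)

lemma Ck_1_iff:
  "Ck (Suc 0) f \<longleftrightarrow> (\<forall>x. f differentiable (at x)) \<and> continuous_on UNIV (grad f)"
  unfolding Ck.simps continuous_on_componentwise[of UNIV "grad f"] by (rule refl)

text \<open>One derivative carries all the integral identities below. The class is closed under
  differences and products by the rules for \<open>GDERIV\<close>, without an induction over the
  orders of \<open>Ck\<close>; squares and differences of test functions are therefore treated as
  its elements.\<close>

definition C1_functions :: "'a::euclidean_space set \<Rightarrow> ('a \<Rightarrow> real) set"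
  where "C1_functions \<Omega> =
    {\<phi>. Ck (Suc 0) \<phi> \<and> compact (closure {x. \<phi> x \<noteq> 0}) \<and> closure {x. \<phi> x \<noteq> 0} \<subseteq> \<Omega>}"

lemma test_functions_subset_C1: "test_functions \<Omega> \<subseteq> C1_functions \<Omega>"
  by (auto simp: test_functions_def C1_functions_def simp del: Ck.simps)

lemma C1_GDERIV: "\<phi> \<in> C1_functions \<Omega> \<Longrightarrow> GDERIV \<phi> x :> grad \<phi> x"
  by (auto simp: C1_functions_def Ck_1_iff GDERIV_grad simp del: Ck.simps)

lemma C1_continuous_grad: "\<phi> \<in> C1_functions \<Omega> \<Longrightarrow> continuous_on S (grad \<phi>)"
  by (auto simp: C1_functions_def Ck_1_iff simp del: Ck.simps intro: continuous_on_subset)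

lemma C1_continuous:
  assumes "\<phi> \<in> C1_functions \<Omega>"
  shows "continuous_on S \<phi>"
proof (rule continuous_at_imp_continuous_on, rule ballI)
  show "isCont \<phi> x" for x
    using has_derivative_continuous[OF C1_GDERIV[OF assms, unfolded gderiv_def]] .
qed

lemma C1_measurable:
  assumes "\<phi> \<in> C1_functions \<Omega>"
  shows "\<phi> \<in> borel_measurable borel" "grad \<phi> \<in> borel_measurable borel"
  using assms by (auto intro!: borel_measurable_continuous_onI C1_continuous C1_continuous_grad)

lemma C1_zero_outside:
  assumes "\<phi> \<in> C1_functions \<Omega>" "x \<notin> closure {x. \<phi> x \<noteq> 0}"
  shows "\<phi> x = 0" "grad \<phi> x = 0"
proof -
  show "\<phi> x = 0" using assms(2) closure_subset[of "{x. \<phi> x \<noteq> 0}"] by auto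
  have "GDERIV \<phi> x :> 0"
    unfolding gderiv_def inner_zero_right
  proof (rule has_derivative_transform_within_open)
    show "((\<lambda>_. 0) has_derivative (\<lambda>h. 0)) (at x)" by simp
    show "open (- closure {x. \<phi> x \<noteq> 0})" "x \<in> - closure {x. \<phi> x \<noteq> 0}" using assms by auto
    show "0 = \<phi> y" if "y \<in> - closure {x. \<phi> x \<noteq> 0}" for y
      using that closure_subset[of "{x. \<phi> x \<noteq> 0}"] by auto
  qed
  then show "grad \<phi> x = 0" by (rule grad_eqI)
qed

lemma C1_zero_outside_domain:
  assumes "\<phi> \<in> C1_functions \<Omega>" "x \<notin> \<Omega>"
  shows "\<phi> x = 0" "grad \<phi> x = 0"
  using assms C1_zero_outside[OF assms(1), of x] by (auto simp: C1_functions_def)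

lemma C1_bounds:
  assumes \<phi>: "\<phi> \<in> C1_functions \<Omega>"
  obtains C R where "C > 0" "R > 0" "\<And>x. \<bar>\<phi> x\<bar> \<le> C" "\<And>x. norm (grad \<phi> x) \<le> C"
    "\<And>x. R \<le> norm x \<Longrightarrow> \<phi> x = 0" "\<And>x. R \<le> norm x \<Longrightarrow> grad \<phi> x = 0"
proof -
  let ?K = "closure {x. \<phi> x \<noteq> 0}"
  have K: "compact ?K" using \<phi> by (auto simp: C1_functions_def)
  obtain R0 where R0: "R0 > 0" "\<And>x. x \<in> ?K \<Longrightarrow> norm x \<le> R0"
    using compact_imp_bounded[OF K] unfolding bounded_pos by blast
  obtain C1 where C1: "C1 > 0" "\<And>x. x \<in> ?K \<Longrightarrow> norm (\<phi> x) \<le> C1"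
    using compact_imp_bounded[OF compact_continuous_image[OF C1_continuous[OF \<phi>] K]]
    unfolding bounded_pos by blast
  obtain C2 where C2: "C2 > 0" "\<And>x. x \<in> ?K \<Longrightarrow> norm (grad \<phi> x) \<le> C2"
    using compact_imp_bounded[OF compact_continuous_image[OF C1_continuous_grad[OF \<phi>] K]]
    unfolding bounded_pos by blast
  show ?thesis
  \<comment> \<open>The radius is enlarged by 1 because \<open>R0\<close> itself may be attained on
    the support.\<close>
  proof (rule that[of "max C1 C2" "R0 + 1"])
    show "\<bar>\<phi> x\<bar> \<le> max C1 C2" for x
      using C1 C1_zero_outside[OF \<phi>, of x] by (cases "x \<in> ?K") fastforce+
    show "norm (grad \<phi> x) \<le> max C1 C2" for x
      using C2 C1_zero_outside[OF \<phi>, of x] by (cases "x \<in> ?K") fastforce+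
    show "\<phi> x = 0" "grad \<phi> x = 0" if "R0 + 1 \<le> norm x" for x
      using R0(2)[of x] that C1_zero_outside[OF \<phi>, of x] by fastforce+
    show "max C1 C2 > 0" "R0 + 1 > 0" using C1(1) R0(1) by auto
  qed
qed

text \<open>Covers differences and products alike: the condition on zeros puts the support of
  \<open>q\<close> into the union of the two supports, which is compact and lies in the
  domain.\<close>

lemma C1_functionsI:
  assumes \<phi>: "\<phi> \<in> C1_functions \<Omega>" and psi: "\<psi> \<in> C1_functions \<Omega>"
    and s: "\<And>x. \<phi> x = 0 \<Longrightarrow> \<psi> x = 0 \<Longrightarrow> q x = 0"
    and d: "\<And>x. GDERIV q x :> g x" and g: "continuous_on UNIV g"
  shows "q \<in> C1_functions \<Omega>" "grad q = g"
proof -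
  show g': "grad q = g" by (rule ext) (rule grad_eqI[OF d])
  have "closure {x. q x \<noteq> 0} \<subseteq> closure ({x. \<phi> x \<noteq> 0} \<union> {x. \<psi> x \<noteq> 0})"
    using s by (intro closure_mono) auto
  then have sub: "closure {x. q x \<noteq> 0} \<subseteq> closure {x. \<phi> x \<noteq> 0} \<union> closure {x. \<psi> x \<noteq> 0}"
    by (simp add: closure_Un)
  have c: "compact (closure {x. \<phi> x \<noteq> 0} \<union> closure {x. \<psi> x \<noteq> 0})"
    using \<phi> psi by (auto simp: C1_functions_def)
  have "compact ((closure {x. \<phi> x \<noteq> 0} \<union> closure {x. \<psi> x \<noteq> 0}) \<inter> closure {x. q x \<noteq> 0})"
    by (rule compact_Int_closed[OF c]) simp
  then have "compact (closure {x. q x \<noteq> 0})" using sub by (simp add: Int_absorb1)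
  moreover have "closure {x. q x \<noteq> 0} \<subseteq> \<Omega>" using sub \<phi> psi by (auto simp: C1_functions_def)
  moreover have "Ck (Suc 0) q"
    unfolding Ck_1_iff g' using g GDERIV_imp_differentiable[OF d] by simp
  ultimately show "q \<in> C1_functions \<Omega>" by (simp add: C1_functions_def del: Ck.simps)
qed

lemma
  assumes \<phi>: "\<phi> \<in> C1_functions \<Omega>" and psi: "\<psi> \<in> C1_functions \<Omega>"
  shows C1_diff: "(\<lambda>x. \<phi> x - \<psi> x) \<in> C1_functions \<Omega>"
    and grad_C1_diff: "grad (\<lambda>x. \<phi> x - \<psi> x) = (\<lambda>x. grad \<phi> x - grad \<psi> x)"
    and C1_mult: "(\<lambda>x. \<phi> x * \<psi> x) \<in> C1_functions \<Omega>"
    and grad_C1_mult: "grad (\<lambda>x. \<phi> x * \<psi> x) = (\<lambda>x. \<phi> x *\<^sub>R grad \<psi> x + \<psi> x *\<^sub>R grad \<phi> x)"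
proof -
  note cont = continuous_intros C1_continuous[OF \<phi>] C1_continuous[OF psi]
    C1_continuous_grad[OF \<phi>] C1_continuous_grad[OF psi]
  have c1: "continuous_on UNIV (\<lambda>x. grad \<phi> x - grad \<psi> x)"
    and c2: "continuous_on UNIV (\<lambda>x. \<phi> x *\<^sub>R grad \<psi> x + \<psi> x *\<^sub>R grad \<phi> x)"
    by (intro cont)+
  note d1 = GDERIV_diff[OF C1_GDERIV[OF \<phi>] C1_GDERIV[OF psi]]
  note d2 = GDERIV_mult[OF C1_GDERIV[OF \<phi>] C1_GDERIV[OF psi]]
  show "(\<lambda>x. \<phi> x - \<psi> x) \<in> C1_functions \<Omega>"
    by (rule C1_functionsI(1)[OF \<phi> psi _ d1 c1]) simp
  show "grad (\<lambda>x. \<phi> x - \<psi> x) = (\<lambda>x. grad \<phi> x - grad \<psi> x)"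
    by (rule C1_functionsI(2)[OF \<phi> psi _ d1 c1]) simp
  show "(\<lambda>x. \<phi> x * \<psi> x) \<in> C1_functions \<Omega>"
    by (rule C1_functionsI(1)[OF \<phi> psi _ d2 c2]) simp
  show "grad (\<lambda>x. \<phi> x * \<psi> x) = (\<lambda>x. \<phi> x *\<^sub>R grad \<psi> x + \<psi> x *\<^sub>R grad \<phi> x)"
    by (rule C1_functionsI(2)[OF \<phi> psi _ d2 c2]) simp
qed

text \<open>Here the second derivatives of a test function enter. Its partial derivatives become
  admissible in the weak formulation, and the uniqueness of limit gradients rests on testing with
  them.\<close>

lemma test_function_partial_derivative_C1:
  assumes \<phi>: "\<phi> \<in> test_functions \<Omega>" and b: "b \<in> Basis"
  shows "(\<lambda>x. grad \<phi> x \<bullet> b) \<in> C1_functions \<Omega>"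
proof -
  have \<phi>': "\<phi> \<in> C1_functions \<Omega>" using \<phi> test_functions_subset_C1 by blast
  have "Ck (Suc (Suc 0)) \<phi>" using \<phi> by (auto simp: test_functions_def simp del: Ck.simps)
  then have C: "Ck (Suc 0) (\<lambda>x. grad \<phi> x \<bullet> b)" using b by (subst (asm) Ck.simps) blast
  have "{x. grad \<phi> x \<bullet> b \<noteq> 0} \<subseteq> closure {x. \<phi> x \<noteq> 0}"
    by (rule subsetI, rule ccontr) (simp add: C1_zero_outside(2)[OF \<phi>'])
  then have sub: "closure {x. grad \<phi> x \<bullet> b \<noteq> 0} \<subseteq> closure {x. \<phi> x \<noteq> 0}"
    by (rule closure_minimal) simp
  have c: "compact (closure {x. \<phi> x \<noteq> 0})" "closure {x. \<phi> x \<noteq> 0} \<subseteq> \<Omega>"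
    using \<phi>' by (auto simp: C1_functions_def)
  have "compact (closure {x. \<phi> x \<noteq> 0} \<inter> closure {x. grad \<phi> x \<bullet> b \<noteq> 0})"
    by (rule compact_Int_closed[OF c(1)]) simp
  with sub C c(2) show ?thesis
    by (auto simp: C1_functions_def Int_absorb1 simp del: Ck.simps)
qed

lemma C1_Lipschitz:
  assumes \<phi>: "\<phi> \<in> C1_functions \<Omega>" and C: "\<And>x. norm (grad \<phi> x) \<le> C"
  shows "\<bar>\<phi> x - \<phi> y\<bar> \<le> C * norm (x - y)"
proof -
  have "norm (\<phi> x - \<phi> y) \<le> C * norm (x - y)"
  proof (rule differentiable_bound[of UNIV \<phi> "\<lambda>x h. h \<bullet> grad \<phi> x"])
    show "(\<phi> has_derivative (\<lambda>h. h \<bullet> grad \<phi> x)) (at x within UNIV)" for x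
      using C1_GDERIV[OF \<phi>, of x] by (simp add: gderiv_def)
    show "onorm (\<lambda>h. h \<bullet> grad \<phi> x) \<le> C" for x
    proof (rule onorm_bound)
      show "0 \<le> C" using C[of x] norm_ge_zero[of "grad \<phi> x"] by linarith
      show "norm (h \<bullet> grad \<phi> x) \<le> C * norm h" for h
        using Cauchy_Schwarz_ineq2[of h "grad \<phi> x"] mult_left_mono[OF C[of x], of "norm h"]
        by (simp add: mult.commute)
    qed
  qed auto
  then show ?thesis by simp
qed

lemma C1_integrable_lborel:
  assumes \<phi>: "\<phi> \<in> C1_functions \<Omega>"
  shows "integrable lborel \<phi>"
proof -
  obtain C R where B: "C > 0" "R > 0" "\<And>x. \<bar>\<phi> x\<bar> \<le> C" "\<And>x. norm (grad \<phi> x) \<le> C"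
    "\<And>x. R \<le> norm x \<Longrightarrow> \<phi> x = 0" "\<And>x. R \<le> norm x \<Longrightarrow> grad \<phi> x = 0"
    using C1_bounds[OF \<phi>] by blast
  have "integrable lborel (\<lambda>x. indicator (cball 0 R) x *\<^sub>R \<phi> x)"
    by (rule borel_integrable_compact) (auto intro: C1_continuous[OF \<phi>])
  also have "(\<lambda>x. indicator (cball 0 R) x *\<^sub>R \<phi> x) = \<phi>"
    using B(5) by (auto simp: indicator_def fun_eq_iff)
  finally show ?thesis .
qed

section \<open>Integration by parts and the radial identity\<close>

text \<open>The difference quotients in direction \<open>b\<close> have integral 0 by translation
  invariance, and they converge to the directional derivative under a common integrable
  bound.\<close>

lemma integral_partial_derivative_eq_0:
  fixes \<phi> :: "'a::euclidean_space \<Rightarrow> real"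
  assumes \<phi>: "\<phi> \<in> C1_functions \<Omega>"
  shows "(LINT x|lborel. grad \<phi> x \<bullet> b) = 0"
proof -
  obtain C R where B: "C > 0" "R > 0" "\<And>x. \<bar>\<phi> x\<bar> \<le> C" "\<And>x. norm (grad \<phi> x) \<le> C"
    "\<And>x. R \<le> norm x \<Longrightarrow> \<phi> x = 0" "\<And>x. R \<le> norm x \<Longrightarrow> grad \<phi> x = 0"
    using C1_bounds[OF \<phi>] by blast
  note [measurable] = C1_measurable[OF \<phi>]
  define t :: "nat \<Rightarrow> real" where "t n = 1 / real (Suc n)" for n
  have t: "0 < t n" "t n \<le> 1" for n by (auto simp: t_def)
  have t0: "t \<longlonglongrightarrow> 0" unfolding t_def using LIMSEQ_inverse_real_of_nat by (simp add: inverse_eq_divide)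
  define s where "s n x = (\<phi> (t n *\<^sub>R b + x) - \<phi> x) / t n" for n x
  have "(\<lambda>n. LINT x|lborel. s n x) \<longlonglongrightarrow> (LINT x|lborel. grad \<phi> x \<bullet> b)"
  \<comment> \<open>Since \<open>t n \<le> 1\<close>, a shift moves points by at most
    \<open>norm b\<close>, so all quotients vanish outside the enlarged ball; inside it they are
    bounded by the Lipschitz constant times \<open>norm b\<close>.\<close>
  proof (rule integral_dominated_convergence[where w="\<lambda>x. C * norm b * indicator (cball 0 (R + norm b)) x"])
    show "integrable lborel (\<lambda>x::'a. C * norm b * indicator (cball 0 (R + norm b)) x)"
      by (intro integrable_mult_right integrable_real_indicator) (auto intro: emeasure_lborel_cball_finite[unfolded infinity_ennreal_def])
    show "AE x in lborel. (\<lambda>n. s n x) \<longlonglongrightarrow> grad \<phi> x \<bullet> b"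
    proof (rule AE_I2)
      fix x
      have d: "((\<lambda>\<tau>. \<phi> (\<tau> *\<^sub>R b + x)) has_derivative (\<lambda>\<tau>. (\<tau> *\<^sub>R b) \<bullet> grad \<phi> x)) (at 0)"
      proof (rule has_derivative_compose[of "\<lambda>\<tau>. \<tau> *\<^sub>R b + x" "\<lambda>\<tau>. \<tau> *\<^sub>R b" 0 UNIV \<phi> "\<lambda>h. h \<bullet> grad \<phi> x"])
        show "((\<lambda>\<tau>. \<tau> *\<^sub>R b + x) has_derivative (\<lambda>\<tau>. \<tau> *\<^sub>R b)) (at 0)"
          by (auto intro!: derivative_eq_intros)
        show "(\<phi> has_derivative (\<lambda>h. h \<bullet> grad \<phi> x)) (at (0 *\<^sub>R b + x))"
          using C1_GDERIV[OF \<phi>, of x] by (simp add: gderiv_def)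
      qed
      then have "DERIV (\<lambda>\<tau>. \<phi> (\<tau> *\<^sub>R b + x)) 0 :> b \<bullet> grad \<phi> x"
        by (simp add: has_field_derivative_def mult_commute_abs)
      then have "(\<lambda>h. (\<phi> (h *\<^sub>R b + x) - \<phi> x) / h) \<midarrow>0\<rightarrow> b \<bullet> grad \<phi> x"
        by (simp add: DERIV_def)
      then have "(\<lambda>n. (\<phi> (t n *\<^sub>R b + x) - \<phi> x) / t n) \<longlonglongrightarrow> b \<bullet> grad \<phi> x"
      proof (rule filterlim_compose)
        show "filterlim t (at 0) sequentially"
          unfolding filterlim_at using t0 t(1) by (auto simp: less_imp_neq[symmetric])
      qed
      then show "(\<lambda>n. s n x) \<longlonglongrightarrow> grad \<phi> x \<bullet> b" by (simp add: s_def inner_commute)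
    qed
    show "AE x in lborel. norm (s n x) \<le> C * norm b * indicator (cball 0 (R + norm b)) x" for n
    proof (rule AE_I2)
      fix x :: 'a
      show "norm (s n x) \<le> C * norm b * indicator (cball 0 (R + norm b)) x"
      proof (cases "x \<in> cball 0 (R + norm b)")
        case True
        have "\<bar>\<phi> (t n *\<^sub>R b + x) - \<phi> x\<bar> \<le> C * norm (t n *\<^sub>R b + x - x)"
          by (rule C1_Lipschitz[OF \<phi> B(4)])
        then have "\<bar>\<phi> (t n *\<^sub>R b + x) - \<phi> x\<bar> \<le> (C * norm b) * t n"
          using t(1)[of n] by (simp add: mult_ac)
        then show ?thesis using True t(1)[of n] by (simp add: s_def pos_divide_le_eq)
      next
        case False
        then have x: "norm x > R + norm b" by simp
        have "norm (t n *\<^sub>R b) \<le> norm b" using t[of n] by (simp add: mult_left_le_one_le)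
        then have "R \<le> norm (t n *\<^sub>R b + x)"
          using norm_diff_ineq[of x "t n *\<^sub>R b"] x by (simp add: add.commute)
        moreover have "R \<le> norm x" using x norm_ge_zero[of b] by linarith
        ultimately show ?thesis using False by (simp add: s_def B(5))
      qed
    qed
  qed (auto simp: s_def)
  moreover have "(LINT x|lborel. s n x) = 0" for n
  proof -
    have i: "integrable lborel \<phi>" by (rule C1_integrable_lborel[OF \<phi>])
    have dl: "distr lborel borel ((+) (t n *\<^sub>R b)) = (lborel :: 'a measure)" by (rule lborel_distr_plus)
    have i': "integrable lborel (\<lambda>x. \<phi> (t n *\<^sub>R b + x))"
      using i by (subst (asm) dl[symmetric], subst (asm) integrable_distr_eq) auto
    have "(LINT x|lborel. \<phi> x) = (LINT x|lborel. \<phi> (t n *\<^sub>R b + x))"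
      by (subst dl[symmetric], subst integral_distr) auto
    then show ?thesis unfolding s_def using i i' by simp
  qed
  ultimately show ?thesis by (simp add: LIMSEQ_const_iff)
qed

lemma integrable_outside_ball:
  fixes F :: "'a::euclidean_space \<Rightarrow> real"
  assumes e: "e > 0" and F: "continuous_on (- {0}) F" and z: "\<And>x. R \<le> norm x \<Longrightarrow> F x = 0"
  shows "integrable lborel (\<lambda>x. indicator {x. e \<le> norm x} x * F x)"
proof -
  have K: "compact (cball (0::'a) R - ball 0 e)" by (intro compact_diff compact_cball open_ball)
  have "integrable lborel (\<lambda>x. indicator (cball 0 R - ball 0 e) x *\<^sub>R F x)"
    by (rule borel_integrable_compact[OF K]) (rule continuous_on_subset[OF F], use e in auto)
  also have "(\<lambda>x. indicator (cball 0 R - ball 0 e) x *\<^sub>R F x) = (\<lambda>x. indicator {x. e \<le> norm x} x * F x)"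
    using z by (auto simp: indicator_def fun_eq_iff)
  finally show ?thesis .
qed

text \<open>In polar coordinates the integrand is the radial derivative of \<open>r ^ k * f\<close>.\<close>

lemma integral_radial_derivative:
  fixes f :: "'a::euclidean_space \<Rightarrow> real"
  assumes f: "f \<in> C1_functions \<Omega>" and e: "e > 0"
  shows "(LINT x|lborel. indicator {x. e \<le> norm x} x *
             (norm x ^ k / norm x ^ DIM('a) * (real k * f x + x \<bullet> grad f x)))
       = - real DIM('a) * e ^ k * (LINT s|direction_measure. f (e *\<^sub>R s))"
proof -
  obtain C R0 where B: "C > 0" "R0 > 0" "\<And>x. \<bar>f x\<bar> \<le> C" "\<And>x. norm (grad f x) \<le> C"
    "\<And>x. R0 \<le> norm x \<Longrightarrow> f x = 0" "\<And>x. R0 \<le> norm x \<Longrightarrow> grad f x = 0"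
    using C1_bounds[OF f] by blast
  \<comment> \<open>At least \<open>e\<close>, so that \<open>{e..R}\<close> is a proper range for
    the fundamental theorem even if the support lies inside the ball of radius
    \<open>e\<close>.\<close>
  define R where "R = max R0 e"
  have R: "e \<le> R" "R0 \<le> R" by (auto simp: R_def)
  let ?N = "DIM('a)"
  let ?F = "\<lambda>x. norm x ^ k / norm x ^ ?N * (real k * f x + x \<bullet> grad f x)"
  have "integrable lborel (\<lambda>x. indicator {x. e \<le> norm x} x * ?F x)"
    by (rule integrable_outside_ball[OF e, where R=R0])
      (auto intro!: continuous_intros C1_continuous[OF f] C1_continuous_grad[OF f] simp: B(5,6))
  then have "(LINT x|lborel. indicator {x. e \<le> norm x} x * ?F x)
     = (LINT s|direction_measure. LINT r|lborel. real ?N * r ^ (?N - 1) * indicator {0<..} r *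
          (indicator {x. e \<le> norm x} (r *\<^sub>R s) * ?F (r *\<^sub>R s)))"
    by (rule integral_polar)
  also have "\<dots> = (LINT s|direction_measure. - real ?N * e ^ k * f (e *\<^sub>R s))"
  proof (rule integral_cong_AE)
    show "(\<lambda>s. LINT r|lborel. real ?N * r ^ (?N - 1) * indicator {0<..} r *
          (indicator {x. e \<le> norm x} (r *\<^sub>R s) * ?F (r *\<^sub>R s))) \<in> borel_measurable direction_measure"
      using C1_measurable[OF f, measurable] by measurable
    show "(\<lambda>s. - real ?N * e ^ k * f (e *\<^sub>R s)) \<in> borel_measurable direction_measure"
      using C1_measurable[OF f, measurable] by measurable
    show "AE s in direction_measure. (LINT r|lborel. real ?N * r ^ (?N - 1) * indicator {0<..} r *
          (indicator {x. e \<le> norm x} (r *\<^sub>R s) * ?F (r *\<^sub>R s))) = - real ?N * e ^ k * f (e *\<^sub>R s)"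
      using AE_direction_norm
    proof eventually_elim
      fix s :: 'a assume s: "norm s = 1"
      let ?g = "\<lambda>r. real ?N * (real k * r ^ (k - 1) * f (r *\<^sub>R s) + r ^ k * (s \<bullet> grad f (r *\<^sub>R s)))"
      have "(LINT r|lborel. real ?N * r ^ (?N - 1) * indicator {0<..} r *
          (indicator {x. e \<le> norm x} (r *\<^sub>R s) * ?F (r *\<^sub>R s)))
        = (LINT r|lborel. ?g r * indicator {e..R} r)"
      proof (rule Bochner_Integration.integral_cong[OF refl])
        fix r :: real
        show "real ?N * r ^ (?N - 1) * indicator {0<..} r *
          (indicator {x. e \<le> norm x} (r *\<^sub>R s) * ?F (r *\<^sub>R s)) = ?g r * indicator {e..R} r"
        proof (cases "e \<le> r")
          case True
          then have r: "r > 0" using e by simp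
          have n: "norm (r *\<^sub>R s) = r" using r s by simp
          have p: "r ^ (?N - 1) * (r ^ k / r ^ ?N) = r ^ k / r"
            using r DIM_positive[where 'a='a] by (cases ?N) (auto simp: field_simps)
          \<comment> \<open>For \<open>k = 0\<close> the exponent \<open>k - 1\<close> is truncated
            to 0, which is harmless because the factor \<open>real k\<close> vanishes.\<close>
          have q: "real k * (r ^ k / r) = real k * r ^ (k - 1)"
            using r by (cases k) auto
          show ?thesis
          proof (cases "r \<le> R")
            case True
            have "real ?N * r ^ (?N - 1) * ?F (r *\<^sub>R s)
                = real ?N * (r ^ (?N - 1) * (r ^ k / r ^ ?N)) * (real k * f (r *\<^sub>R s) + r * (s \<bullet> grad f (r *\<^sub>R s)))"
              unfolding n by simp
            also have "\<dots> = real ?N * (real k * (r ^ k / r) * f (r *\<^sub>R s) + r ^ k / r * r * (s \<bullet> grad f (r *\<^sub>R s)))"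
              unfolding p by (simp add: algebra_simps)
            also have "\<dots> = ?g r" unfolding q using r by simp
            finally show ?thesis using r n \<open>e \<le> r\<close> True by simp
          next
            case False
            then have "f (r *\<^sub>R s) = 0" "grad f (r *\<^sub>R s) = 0" using B(5,6)[of "r *\<^sub>R s"] n R by auto
            then show ?thesis by simp
          qed
        next
          case False
          then show ?thesis using s by (auto simp: indicator_def)
        qed
      qed
      also have "\<dots> = real ?N * R ^ k * f (R *\<^sub>R s) - real ?N * e ^ k * f (e *\<^sub>R s)"
      proof (rule integral_FTC_Icc_real[OF R(1)])
        fix r
        have d: "((\<lambda>r. f (r *\<^sub>R s)) has_derivative (\<lambda>h. (h *\<^sub>R s) \<bullet> grad f (r *\<^sub>R s))) (at r)"
        proof (rule has_derivative_compose[of "\<lambda>r. r *\<^sub>R s" "\<lambda>h. h *\<^sub>R s" r UNIV f "\<lambda>h. h \<bullet> grad f (r *\<^sub>R s)"])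
          show "((\<lambda>r. r *\<^sub>R s) has_derivative (\<lambda>h. h *\<^sub>R s)) (at r)"
            by (auto intro!: derivative_eq_intros)
          show "(f has_derivative (\<lambda>h. h \<bullet> grad f (r *\<^sub>R s))) (at (r *\<^sub>R s))"
            using C1_GDERIV[OF f] by (simp add: gderiv_def)
        qed
        then have d': "((\<lambda>r. f (r *\<^sub>R s)) has_real_derivative s \<bullet> grad f (r *\<^sub>R s)) (at r)"
          by (simp add: has_field_derivative_def mult_commute_abs)
        show "((\<lambda>r. real ?N * r ^ k * f (r *\<^sub>R s)) has_real_derivative ?g r) (at r)"
          by (rule derivative_eq_intros d' refl | simp add: algebra_simps)+
        have "continuous_on UNIV ?g"
          by (intro continuous_intros continuous_on_compose2[OF C1_continuous[OF f, of UNIV]]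
              continuous_on_compose2[OF C1_continuous_grad[OF f, of UNIV]]) auto
        then show "isCont ?g r" by (simp add: continuous_on_eq_continuous_at)
      qed
      also have "f (R *\<^sub>R s) = 0" using B(5)[of "R *\<^sub>R s"] R s B(2) by simp
      finally show "(LINT r|lborel. real ?N * r ^ (?N - 1) * indicator {0<..} r *
          (indicator {x. e \<le> norm x} (r *\<^sub>R s) * ?F (r *\<^sub>R s))) = - real ?N * e ^ k * f (e *\<^sub>R s)"
        by simp
    qed
  qed
  also have "\<dots> = - real ?N * e ^ k * (LINT s|direction_measure. f (e *\<^sub>R s))"
    by simp
  finally show ?thesis .
qed

lemma integral_dominated_convergence_at_right_0:
  fixes F :: "real \<Rightarrow> 'a \<Rightarrow> real"
  assumes [measurable]: "f \<in> borel_measurable M" and m: "\<And>e. e > 0 \<Longrightarrow> F e \<in> borel_measurable M"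
    and w: "integrable M w"
    and lim: "AE x in M. ((\<lambda>e. F e x) \<longlongrightarrow> f x) (at_right 0)"
    and b: "\<And>e. e > 0 \<Longrightarrow> AE x in M. norm (F e x) \<le> w x"
  shows "((\<lambda>e. LINT x|M. F e x) \<longlongrightarrow> (LINT x|M. f x)) (at_right 0)"
  unfolding tendsto_at_iff_sequentially comp_def
proof (intro allI impI)
  fix X :: "nat \<Rightarrow> real" assume X: "\<forall>i. X i \<in> {0<..} - {0}" "X \<longlonglongrightarrow> 0"
  show "(\<lambda>n. LINT x|M. F (X n) x) \<longlonglongrightarrow> (LINT x|M. f x)"
  proof (rule integral_dominated_convergence[OF assms(1) _ w])
    show "F (X n) \<in> borel_measurable M" "AE x in M. norm (F (X n) x) \<le> w x" for n
      using X(1) m b by auto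
    show "AE x in M. (\<lambda>n. F (X n) x) \<longlonglongrightarrow> f x"
      using lim
    proof eventually_elim
      fix x assume "((\<lambda>e. F e x) \<longlongrightarrow> f x) (at_right 0)"
      then show "(\<lambda>n. F (X n) x) \<longlonglongrightarrow> f x"
        using X unfolding tendsto_at_iff_sequentially comp_def by blast
    qed
  qed
qed

text \<open>Away from the origin the truncation is eventually constant. At the origin it is 0 for
  every \<open>e > 0\<close>, whence the condition on \<open>g 0\<close>.\<close>

lemma tendsto_indicator_outside_ball:
  fixes g :: "'a::real_normed_vector \<Rightarrow> real"
  assumes "g 0 = 0"
  shows "((\<lambda>e. indicator {x. e \<le> norm x} x * g x) \<longlongrightarrow> g x) (at_right 0)"
proof (cases "x = 0")
  case False
  then have "\<forall>\<^sub>F e in at_right 0. e < norm x"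
    by (intro eventually_at_right_real[THEN eventually_mono]) auto
  then have "\<forall>\<^sub>F e in at_right 0. g x = indicator {x. e \<le> norm x} x * g x"
    by eventually_elim auto
  then show ?thesis by (rule Lim_transform_eventually[OF tendsto_const])
qed (simp add: assms)

lemma integral_outside_ball_tendsto:
  fixes g :: "'a::euclidean_space \<Rightarrow> real"
  assumes g: "integrable lborel g" and "g 0 = 0"
  shows "((\<lambda>e. LINT x|lborel. indicator {x. e \<le> norm x} x * g x) \<longlongrightarrow> (LINT x|lborel. g x)) (at_right 0)"
proof (rule integral_dominated_convergence_at_right_0[where w="\<lambda>x. norm (g x)"])
  have [measurable]: "g \<in> borel_measurable lborel" using g by simp
  show "g \<in> borel_measurable lborel" by measurable
  show "(\<lambda>x. indicator {x. e \<le> norm x} x * g x) \<in> borel_measurable lborel" for e by measurable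
  show "AE x in lborel. ((\<lambda>e. indicator {x. e \<le> norm x} x * g x) \<longlongrightarrow> g x) (at_right 0)"
    using tendsto_indicator_outside_ball[of g] assms(2) by simp
  show "AE x in lborel. norm (indicator {x. e \<le> norm x} x * g x) \<le> norm (g x)" for e
    by (simp add: indicator_def)
qed (use g in simp)

text \<open>Continuity at the origin under a constant bound. The integral is not normalised, so the
  mass of \<open>direction_measure\<close> appears in the limit.\<close>

lemma C1_spherical_mean_tendsto:
  fixes f :: "'a::euclidean_space \<Rightarrow> real"
  assumes f: "f \<in> C1_functions \<Omega>"
  shows "((\<lambda>e. LINT s|direction_measure. f (e *\<^sub>R s))
    \<longlongrightarrow> f 0 * measure lebesgue (ball (0::'a) 1)) (at_right 0)"
proof -
  note [measurable] = C1_measurable[OF f]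
  obtain C where C: "\<And>x. \<bar>f x\<bar> \<le> C" using C1_bounds[OF f] by metis
  have "((\<lambda>e. LINT s|direction_measure. f (e *\<^sub>R s)) \<longlongrightarrow> (LINT s|(direction_measure::'a measure). f 0)) (at_right 0)"
  proof (rule integral_dominated_convergence_at_right_0[where F="\<lambda>e s. f (e *\<^sub>R s)" and f="\<lambda>_. f 0" and w="\<lambda>_. C"])
    show "AE s in direction_measure. ((\<lambda>e. f (e *\<^sub>R s)) \<longlongrightarrow> f 0) (at_right 0)"
    proof (rule AE_I2)
      fix s :: 'a
      have c: "isCont f (0 *\<^sub>R s)"
        using C1_continuous[OF f, of UNIV] by (simp add: continuous_on_eq_continuous_at)
      have "((\<lambda>e. e *\<^sub>R s) \<longlongrightarrow> 0 *\<^sub>R s) (at_right 0)"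
        by (intro tendsto_intros)
      from isCont_tendsto_compose[OF c this] show "((\<lambda>e. f (e *\<^sub>R s)) \<longlongrightarrow> f 0) (at_right 0)" by simp
    qed
  qed (auto simp: C)
  then show ?thesis by (simp add: measure_direction_measure_UNIV mult.commute)
qed

section \<open>The weight and the isometry\<close>

text \<open>The quotient of natural powers is the kernel of
  \<open>integral_radial_derivative\<close> for \<open>k = 2\<close>. At the origin both sides are
  0, on the left because \<open>0 powr a = 0\<close>.\<close>

lemma weight_eq:
  assumes "DIM('a::euclidean_space) \<ge> 3"
  shows "weight (x :: 'a) = norm x ^ 2 / norm x ^ DIM('a)"
proof (cases "x = 0")
  case False
  then have p: "norm x > 0" by simp
  have "weight x = norm x powr (real 2 - real DIM('a))" by (simp add: weight_def)
  also have "\<dots> = norm x powr real 2 / norm x powr real DIM('a)" by (rule powr_diff)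
  also have "\<dots> = norm x ^ 2 / norm x ^ DIM('a)"
    by (simp only: powr_realpow[OF p])
  finally show ?thesis .
qed (use assms in \<open>simp add: weight_def\<close>)

lemma norm_powr_hardy_exp: "(norm (x :: 'a::euclidean_space) powr (- hardy_exp TYPE('a)))\<^sup>2 = weight x"
proof -
  have e: "- hardy_exp TYPE('a) + - hardy_exp TYPE('a) = - (real DIM('a) - 2)" by (simp add: hardy_exp_def)
  show ?thesis unfolding power2_eq_square powr_add[symmetric] e weight_def ..
qed

lemma weight_nonneg: "0 \<le> weight x" by (simp add: weight_def)

lemma weight_measurable [measurable]: "weight \<in> borel_measurable borel"
  unfolding weight_def[abs_def] by measurable

text \<open>In polar coordinates the weight cancels all but one power of the volume factor:
  \<open>r ^ (N - 1) * r ^ 2 / r ^ N = r\<close>. Bounding \<open>N * r\<close> by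
  \<open>N * R\<close> on \<open>{0..R}\<close> gives the crude value \<open>N * R * R\<close> for
  each direction.\<close>

lemma weight_locally_integrable:
  assumes N: "DIM('a::euclidean_space) \<ge> 3"
  shows "integrable lborel (\<lambda>x::'a. weight x * indicator (ball 0 R) x)"
proof (rule integrableI_bounded)
  show m: "(\<lambda>x::'a. weight x * indicator (ball 0 R) x) \<in> borel_measurable lborel"
    by (intro borel_measurable_times borel_measurable_indicator) (auto simp: weight_measurable)
  let ?N = "DIM('a)"
  have "(\<integral>\<^sup>+x. ennreal (norm (weight (x::'a) * indicator (ball 0 R) x)) \<partial>lborel)
     = (\<integral>\<^sup>+s. \<integral>\<^sup>+r. ennreal (real ?N * r ^ (?N - 1) * indicator {0<..} r) *
          ennreal (norm (weight (r *\<^sub>R s) * indicator (ball 0 R) (r *\<^sub>R s))) \<partial>lborel \<partial>(direction_measure :: 'a measure))"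
    using m by (intro nn_integral_polar) simp
  also have "\<dots> \<le> (\<integral>\<^sup>+s. ennreal (real ?N * R * R) \<partial>(direction_measure :: 'a measure))"
  proof (rule nn_integral_mono_AE, use AE_direction_norm in eventually_elim)
    fix s :: 'a assume s: "norm s = 1"
    have "(\<integral>\<^sup>+r. ennreal (real ?N * r ^ (?N - 1) * indicator {0<..} r) *
          ennreal (norm (weight (r *\<^sub>R s) * indicator (ball 0 R) (r *\<^sub>R s))) \<partial>lborel)
        \<le> (\<integral>\<^sup>+r. ennreal (real ?N * R) * indicator {0..R} r \<partial>lborel)"
    proof (rule nn_integral_mono)
      fix r :: real
      show "ennreal (real ?N * r ^ (?N - 1) * indicator {0<..} r) *
          ennreal (norm (weight (r *\<^sub>R s) * indicator (ball 0 R) (r *\<^sub>R s))) \<le> ennreal (real ?N * R) * indicator {0..R} r"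
      proof (cases "0 < r \<and> r < R")
        case True
        have "r ^ (?N - 1) * (r ^ 2 / r ^ ?N) = r"
          using True DIM_positive[where 'a='a] by (cases ?N) (auto simp: field_simps power2_eq_square)
        then have "real ?N * r ^ (?N - 1) * weight (r *\<^sub>R s) = real ?N * r"
        proof -
          have "weight (r *\<^sub>R s) = r ^ 2 / r ^ ?N" using True s by (simp add: weight_eq[OF N])
          then show ?thesis by (simp only: mult.assoc \<open>r ^ (?N - 1) * (r ^ 2 / r ^ ?N) = r\<close>)
        qed
        then show ?thesis using True s
          by (simp add: ennreal_mult[symmetric] weight_nonneg ennreal_leI mult_left_mono less_imp_le)
      next
        case False
        then show ?thesis using s by (auto simp: indicator_def)
      qed
    qed
    also have "\<dots> \<le> ennreal (real ?N * R * R)"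
    proof (cases "R \<ge> 0")
      case True
      then show ?thesis by (simp add: nn_integral_cmult_indicator ennreal_mult[symmetric])
    qed simp
    finally show "(\<integral>\<^sup>+r. ennreal (real ?N * r ^ (?N - 1) * indicator {0<..} r) *
          ennreal (norm (weight (r *\<^sub>R s) * indicator (ball 0 R) (r *\<^sub>R s))) \<partial>lborel) \<le> ennreal (real ?N * R * R)" .
  qed
  also have "\<dots> = ennreal (real ?N * R * R) * emeasure direction_measure (UNIV :: 'a set)" by simp
  also have "\<dots> < \<infinity>"
    using direction.emeasure_finite[of "UNIV :: 'a set"] unfolding infinity_ennreal_def
    by (simp only: ennreal_mult_less_top less_top ennreal_less_top simp_thms)
  finally show "(\<integral>\<^sup>+x. ennreal (norm (weight (x::'a) * indicator (ball 0 R) x)) \<partial>lborel) < \<infinity>" .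
qed

lemma weight_bounded_integrable:
  fixes g :: "'a::euclidean_space \<Rightarrow> real"
  assumes N: "DIM('a) \<ge> 3" and [measurable]: "g \<in> borel_measurable borel"
    and C: "\<And>x. \<bar>g x\<bar> \<le> C" and R: "\<And>x. R \<le> norm x \<Longrightarrow> g x = 0"
  shows "integrable lborel (\<lambda>x. weight x * g x)"
proof (rule Bochner_Integration.integrable_bound)
  show "integrable lborel (\<lambda>x::'a. C * (weight x * indicator (ball 0 R) x))"
    by (intro integrable_mult_right weight_locally_integrable N)
  show "AE x in lborel. norm (weight x * g x) \<le> norm (C * (weight x * indicator (ball 0 R) x))"
  proof (rule AE_I2)
    fix x :: 'a
    have "C \<ge> 0" using C[of 0] by linarith
    then show "norm (weight x * g x) \<le> norm (C * (weight x * indicator (ball 0 R) x))"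
      using mult_left_mono[OF C[of x] weight_nonneg[of x]] R[of x]
      by (cases "norm x < R") (auto simp: abs_mult weight_nonneg mult.commute)
  qed
qed measurable

lemma C1_weighted_integrable:
  fixes \<phi> :: "'a::euclidean_space \<Rightarrow> real"
  assumes N: "DIM('a) \<ge> 3" and \<phi>: "\<phi> \<in> C1_functions \<Omega>"
  shows "integrable lborel (\<lambda>x. weight x * (\<phi> x)\<^sup>2)" (is ?a)
    and "integrable lborel (\<lambda>x. weight x * (norm (grad \<phi> x))\<^sup>2)" (is ?b)
proof -
  note [measurable] = C1_measurable[OF \<phi>]
  obtain C R where B: "C > 0" "R > 0" "\<And>x. \<bar>\<phi> x\<bar> \<le> C" "\<And>x. norm (grad \<phi> x) \<le> C"
    "\<And>x. R \<le> norm x \<Longrightarrow> \<phi> x = 0" "\<And>x. R \<le> norm x \<Longrightarrow> grad \<phi> x = 0"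
    using C1_bounds[OF \<phi>] by blast
  show ?a
    by (rule weight_bounded_integrable[OF N, of _ "C\<^sup>2" R])
      (use B(1,3,5) in \<open>auto simp: abs_le_square_iff[symmetric]\<close>)
  show ?b
    by (rule weight_bounded_integrable[OF N, of _ "C\<^sup>2" R])
      (use B(1,4,6) in \<open>auto intro!: power_mono\<close>)
qed

text \<open>For the square \<open>f\<close> of \<open>\<phi>\<close> and \<open>k = 2\<close>, the
  radial identity gives \<open>weight x * (2 * \<phi>^2 + 2 * \<phi> * p)\<close> with
  \<open>p = x \<bullet> grad \<phi> x\<close> a nonpositive integral over
  \<open>|x| \<ge> e\<close>. Expanding \<open>(\<phi> + p)^2 \<ge> 0\<close> shows that the second
  factor is at least \<open>\<phi>^2 - p^2\<close>, and
  \<open>\<bar>p\<bar> \<le> R * norm (grad \<phi> x)\<close> on the domain; this is the origin of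
  the constant.\<close>

lemma weighted_Poincare:
  fixes \<phi> :: "'a::euclidean_space \<Rightarrow> real"
  assumes N: "DIM('a) \<ge> 3" and \<phi>: "\<phi> \<in> C1_functions \<Omega>" and R: "\<Omega> \<subseteq> ball 0 R"
  shows "(LINT x|lborel. weight x * (\<phi> x)\<^sup>2) \<le> R\<^sup>2 * (LINT x|lborel. weight x * (norm (grad \<phi> x))\<^sup>2)"
proof -
  note W = C1_weighted_integrable[OF N \<phi>]
  note [measurable] = C1_measurable[OF \<phi>]
  define f where "f x = \<phi> x * \<phi> x" for x
  have f: "f \<in> C1_functions \<Omega>" and gf: "grad f x = (2 * \<phi> x) *\<^sub>R grad \<phi> x" for x
    using C1_mult[OF \<phi> \<phi>] fun_cong[OF grad_C1_mult[OF \<phi> \<phi>], of x]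
    by (simp_all add: f_def[abs_def] scaleR_add_left[symmetric])
  define g where "g x = weight x * (\<phi> x)\<^sup>2 - R\<^sup>2 * (weight x * (norm (grad \<phi> x))\<^sup>2)" for x
  have g: "integrable lborel g" unfolding g_def[abs_def] using W by auto
  have g0: "g 0 = 0" by (simp add: g_def weight_def)
  have le: "g x \<le> norm x ^ 2 / norm x ^ DIM('a) * (real 2 * f x + x \<bullet> grad f x)" for x
  proof (cases "x \<in> \<Omega>")
    case True
    then have x: "norm x \<le> R" using R by auto
    define p where "p = x \<bullet> grad \<phi> x"
    have "p\<^sup>2 \<le> (norm x)\<^sup>2 * (norm (grad \<phi> x))\<^sup>2"
      unfolding p_def using Cauchy_Schwarz_ineq[of x "grad \<phi> x"] by (simp add: power2_norm_eq_inner)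
    also have "\<dots> \<le> R\<^sup>2 * (norm (grad \<phi> x))\<^sup>2" using x by (intro mult_right_mono power_mono) auto
    finally have p: "p\<^sup>2 \<le> R\<^sup>2 * (norm (grad \<phi> x))\<^sup>2" .
    have "0 \<le> (\<phi> x + p)\<^sup>2" by simp
    then have "(\<phi> x)\<^sup>2 - R\<^sup>2 * (norm (grad \<phi> x))\<^sup>2 \<le> 2 * (\<phi> x)\<^sup>2 + 2 * \<phi> x * p"
      using p by (simp add: power2_sum)
    then have "weight x * ((\<phi> x)\<^sup>2 - R\<^sup>2 * (norm (grad \<phi> x))\<^sup>2) \<le> weight x * (2 * (\<phi> x)\<^sup>2 + 2 * \<phi> x * p)"
      by (rule mult_left_mono[OF _ weight_nonneg])
    moreover have "real 2 * f x + x \<bullet> grad f x = 2 * (\<phi> x)\<^sup>2 + 2 * \<phi> x * p"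
      by (simp add: f_def gf p_def power2_eq_square)
    moreover have "g x = weight x * ((\<phi> x)\<^sup>2 - R\<^sup>2 * (norm (grad \<phi> x))\<^sup>2)"
      by (simp add: g_def algebra_simps)
    ultimately show ?thesis by (simp only: weight_eq[OF N])
  next
    case False
    then show ?thesis by (simp add: g_def f_def gf C1_zero_outside_domain[OF \<phi>])
  qed
  obtain R' where R': "\<And>x. R' \<le> norm x \<Longrightarrow> f x = 0" "\<And>x. R' \<le> norm x \<Longrightarrow> grad f x = 0"
    using C1_bounds[OF f] by metis
  have neg: "(LINT x|lborel. indicator {x. e \<le> norm x} x * g x) \<le> 0" if e: "e > 0" for e
  proof -
    have "(LINT x|lborel. indicator {x. e \<le> norm x} x * g x) \<le>
       (LINT x|lborel. indicator {x. e \<le> norm x} x *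
             (norm x ^ 2 / norm x ^ DIM('a) * (real 2 * f x + x \<bullet> grad f x)))"
    proof (rule integral_mono)
      show "integrable lborel (\<lambda>x. indicator {x. e \<le> norm x} x * g x)"
        by (rule Bochner_Integration.integrable_bound[OF g]) (use g in \<open>auto simp: indicator_def\<close>)
      show "integrable lborel (\<lambda>x. indicator {x. e \<le> norm x} x *
             (norm x ^ 2 / norm x ^ DIM('a) * (real 2 * f x + x \<bullet> grad f x)))"
        by (rule integrable_outside_ball[OF e, where R=R'])
          (auto intro!: continuous_intros C1_continuous[OF f] C1_continuous_grad[OF f] simp: R')
    qed (use le in \<open>auto simp: indicator_def\<close>)
    also have "\<dots> = - real DIM('a) * e ^ 2 * (LINT s|direction_measure. f (e *\<^sub>R s))"
      by (rule integral_radial_derivative[OF f e])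
    also have "\<dots> \<le> 0"
      using e by (intro mult_nonpos_nonneg integral_nonneg_AE AE_I2) (auto simp: f_def)
    finally show ?thesis .
  qed
  have "(LINT x|lborel. g x) \<le> 0"
  proof (rule tendsto_upperbound[OF integral_outside_ball_tendsto[OF g g0]])
    show "\<forall>\<^sub>F e in at_right 0. (LINT x|lborel. indicator {x. e \<le> norm x} x * g x) \<le> 0"
      using neg eventually_at_right_less[of "0::real"] by (rule eventually_mono[rotated])
  qed simp
  then show ?thesis unfolding g_def using W by simp
qed

text \<open>\<open>G\<close> is controlled on \<open>A\<close> only. It will be built from
  \<open>u\<close> or \<open>grad u\<close>, singular at the origin, and is replaced by a Borel
  function \<open>F\<close> that is defined without reference to \<open>grad u\<close>.\<close>

lemma set_integral_lebesgue_eq_lborel: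
  fixes F :: "'a::euclidean_space \<Rightarrow> real"
  assumes m: "F \<in> borel_measurable borel" and G: "\<And>x. x \<in> A \<Longrightarrow> G x = F x" and z: "\<And>x. x \<notin> A \<Longrightarrow> F x = 0"
  shows "(LINT x:A|lebesgue. G x) = (LINT x|lborel. F x)"
proof -
  have "(LINT x:A|lebesgue. G x) = (LINT x|lebesgue. F x)"
    unfolding set_lebesgue_integral_def
    by (rule Bochner_Integration.integral_cong) (auto simp: indicator_def G z)
  then show ?thesis using m by (simp add: integral_completion)
qed

lemma W_prenorm_eq:
  assumes \<phi>: "\<phi> \<in> C1_functions \<Omega>"
  shows "W_prenorm \<Omega> \<phi> = sqrt (LINT x|lborel. weight x * (norm (grad \<phi> x))\<^sup>2)"
proof -
  note [measurable] = C1_measurable[OF \<phi>]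
  show ?thesis unfolding W_prenorm_def
    by (subst set_integral_lebesgue_eq_lborel[where F="\<lambda>x. weight x * (norm (grad \<phi> x))\<^sup>2"])
      (auto simp: C1_zero_outside_domain[OF \<phi>])
qed

section \<open>The functional L and the energy on the dense set\<close>

lemma sphere_measure_eq:
  "(sphere_measure \<rho> :: 'a::euclidean_space measure)
     = density (distr direction_measure borel (\<lambda>s. \<rho> *\<^sub>R s)) (\<lambda>_. ennreal (real DIM('a) * \<rho> ^ (DIM('a) - 1)))"
proof (rule measure_eqI)
  have d: "distr (restrict_space lborel (ball (0::'a) 1)) borel (\<lambda>x. \<rho> *\<^sub>R sgn x)
      = distr direction_measure borel (\<lambda>s. \<rho> *\<^sub>R s)"
    unfolding direction_measure_def by (subst distr_distr) (auto simp: comp_def measurable_sgn_ball)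
  fix A assume "A \<in> sets (sphere_measure \<rho> :: 'a measure)"
  then have "A \<in> sets borel" by (simp add: sphere_measure_def)
  then show "emeasure (sphere_measure \<rho>) A
      = emeasure (density (distr direction_measure borel (\<lambda>s. \<rho> *\<^sub>R s)) (\<lambda>_. ennreal (real DIM('a) * \<rho> ^ (DIM('a) - 1)))) A"
    by (subst emeasure_density) (auto simp: sphere_measure_def d nn_integral_cmult_indicator)
qed (simp add: sphere_measure_def)

text \<open>The factor \<open>N * \<rho> ^ (N - 1)\<close> occurs both in the integral and in the
  area of the sphere and cancels, leaving a mean over directions.\<close>

lemma radial_part_eq:
  fixes u :: "'a::euclidean_space \<Rightarrow> real"
  assumes [measurable]: "u \<in> borel_measurable borel" and z: "\<And>x. x \<notin> \<Omega> \<Longrightarrow> u x = 0" and \<rho>: "\<rho> > 0"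
  shows "radial_part \<Omega> u \<rho> = (LINT s|direction_measure. u (\<rho> *\<^sub>R s)) / measure lebesgue (ball (0::'a) 1)"
proof -
  define c where "c = real DIM('a) * \<rho> ^ (DIM('a) - 1)"
  have c: "c > 0" using \<rho> by (simp add: c_def)
  have "(LINT x|sphere_measure \<rho>. (if x \<in> \<Omega> then u x else 0)) = (LINT x|sphere_measure \<rho>. u x)"
    using z by (intro Bochner_Integration.integral_cong) auto
  also have "\<dots> = c * (LINT s|direction_measure. u (\<rho> *\<^sub>R s))"
    unfolding sphere_measure_eq c_def[symmetric] using c
    by (subst integral_density) (auto simp: integral_distr)
  finally have 1: "(LINT x|sphere_measure \<rho>. (if x \<in> \<Omega> then u x else 0)) = c * (LINT s|direction_measure. u (\<rho> *\<^sub>R s))" .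
  have "emeasure (sphere_measure \<rho>) (sphere (0::'a) \<rho>)
      = ennreal c * emeasure direction_measure ((\<lambda>s::'a. \<rho> *\<^sub>R s) -` sphere 0 \<rho>)"
    unfolding sphere_measure_eq c_def[symmetric]
    by (subst emeasure_density) (auto simp: nn_integral_cmult_indicator emeasure_distr)
  also have "emeasure direction_measure ((\<lambda>s::'a. \<rho> *\<^sub>R s) -` sphere 0 \<rho>) = emeasure direction_measure (UNIV :: 'a set)"
  proof (rule emeasure_eq_AE)
    show "AE s in direction_measure. s \<in> (\<lambda>s::'a. \<rho> *\<^sub>R s) -` sphere 0 \<rho> \<longleftrightarrow> s \<in> UNIV"
      using AE_direction_norm by eventually_elim (use \<rho> in auto)
    have "(\<lambda>s::'a. \<rho> *\<^sub>R s) \<in> borel_measurable borel" by measurable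
    from measurable_sets[OF this, of "sphere 0 \<rho>"]
    show "(\<lambda>s::'a. \<rho> *\<^sub>R s) -` sphere 0 \<rho> \<in> sets direction_measure" by simp
  qed simp
  finally have 2: "measure (sphere_measure \<rho>) (sphere (0::'a) \<rho>) = c * measure lebesgue (ball (0::'a) 1)"
    using c by (simp add: measure_def emeasure_direction_measure_UNIV enn2real_mult)
  show ?thesis unfolding radial_part_def 1 2 using c by simp
qed

context
  fixes \<phi> u :: "'a::euclidean_space \<Rightarrow> real" and \<Omega> and \<alpha> :: real
  assumes N: "DIM('a) \<ge> 3" and \<phi>: "\<phi> \<in> C1_functions \<Omega>"
    and \<alpha>: "\<alpha> = hardy_exp TYPE('a)" and u: "u = (\<lambda>x. norm x powr (- \<alpha>) * \<phi> x)"
begin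

text \<open>On the sphere of radius \<open>\<rho>\<close> the singular factor of \<open>u\<close> is
  the constant \<open>\<rho> powr (- \<alpha>)\<close>. It cancels against
  \<open>\<rho> powr \<alpha>\<close>, and what remains is the spherical mean of
  \<open>\<phi>\<close>, which tends to \<open>\<phi> 0\<close>.\<close>

lemma L_functional_core:
  "(L_functional \<Omega> u)\<^sup>2
     = real DIM('a) * (real DIM('a) - 2) / 2 * measure lebesgue (ball (0::'a) 1) * (\<phi> 0)\<^sup>2"
proof -
  note [measurable] = C1_measurable[OF \<phi>]
  let ?\<omega> = "measure lebesgue (ball (0::'a) 1)"
  have \<omega>: "?\<omega> > 0" by (simp add: content_ball_pos)
  have eq: "\<rho> powr \<alpha> * radial_part \<Omega> u \<rho> = (LINT s|direction_measure. \<phi> (\<rho> *\<^sub>R s)) / ?\<omega>" if \<rho>: "\<rho> > 0" for \<rho>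
  proof -
    have "radial_part \<Omega> u \<rho> = (LINT s|direction_measure. u (\<rho> *\<^sub>R s)) / ?\<omega>"
      by (rule radial_part_eq) (auto simp: u C1_zero_outside_domain[OF \<phi>] \<rho>)
    also have "(LINT s|direction_measure. u (\<rho> *\<^sub>R s)) = (LINT s|direction_measure. \<rho> powr (- \<alpha>) * \<phi> (\<rho> *\<^sub>R s))"
    proof (rule integral_cong_AE)
      show "AE s in direction_measure. u (\<rho> *\<^sub>R s) = \<rho> powr (- \<alpha>) * \<phi> (\<rho> *\<^sub>R s)"
        using AE_direction_norm by eventually_elim (use \<rho> in \<open>auto simp: u\<close>)
    qed (auto simp: u)
    also have "\<dots> = \<rho> powr (- \<alpha>) * (LINT s|direction_measure. \<phi> (\<rho> *\<^sub>R s))" by simp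
    finally show ?thesis using \<rho> by (simp add: powr_minus)
  qed
  have "((\<lambda>\<rho>. (LINT s|direction_measure. \<phi> (\<rho> *\<^sub>R s)) / ?\<omega>) \<longlongrightarrow> \<phi> 0 * ?\<omega> / ?\<omega>) (at_right 0)"
    by (intro tendsto_intros C1_spherical_mean_tendsto[OF \<phi>]) (use \<omega> in simp)
  moreover have "\<forall>\<^sub>F \<rho> in at_right 0. \<rho> powr \<alpha> * radial_part \<Omega> u \<rho> = (LINT s|direction_measure. \<phi> (\<rho> *\<^sub>R s)) / ?\<omega>"
    using eventually_at_right_less[of "0::real"] by eventually_elim (rule eq)
  ultimately have "((\<lambda>\<rho>. \<rho> powr \<alpha> * radial_part \<Omega> u \<rho>) \<longlongrightarrow> \<phi> 0) (at_right 0)"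
    using \<omega> by (simp add: tendsto_cong)
  then have "Lim (at_right 0) (\<lambda>\<rho>. \<rho> powr hardy_exp TYPE('a) * radial_part \<Omega> u \<rho>) = \<phi> 0"
    unfolding \<alpha> by (intro tendsto_Lim) auto
  then show ?thesis unfolding L_functional_def using N by (simp add: power_mult_distrib)
qed

text \<open>The gradient of \<open>u\<close> is \<open>norm x powr (- \<alpha>)\<close> times
  \<open>grad \<phi> x - (\<alpha> * \<phi> x / (norm x)^2) x\<close>, and its square is expanded.
  The spelled out \<open>norm x ^ 0\<close> and \<open>real 0\<close> give the cross term the form
  of \<open>integral_radial_derivative\<close> for \<open>k = 0\<close>.\<close>

lemma norm_grad_core:
  assumes x: "x \<noteq> 0"
  shows "(norm (grad u x))\<^sup>2 = weight x * (norm (grad \<phi> x))\<^sup>2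
    - \<alpha> * (norm x ^ 0 / norm x ^ DIM('a) * (real 0 * (\<phi> x * \<phi> x) + x \<bullet> grad (\<lambda>x. \<phi> x * \<phi> x) x))
    + \<alpha>\<^sup>2 * ((u x)\<^sup>2 / (norm x)\<^sup>2)"
proof -
  define p where "p = norm x powr (- \<alpha>)"
  define n where "n = norm x"
  have n: "n > 0" using x by (simp add: n_def)
  have "GDERIV (\<lambda>x. norm x powr (- \<alpha>)) x :> (- \<alpha> * norm x powr (- \<alpha> - 1)) *\<^sub>R sgn x"
    by (rule GDERIV_DERIV_compose[OF GDERIV_norm[OF x]]) (rule has_real_derivative_powr, use x in simp)
  from GDERIV_mult[OF this C1_GDERIV[OF \<phi>]]
  have "grad u x = p *\<^sub>R grad \<phi> x + \<phi> x *\<^sub>R (- \<alpha> * norm x powr (- \<alpha> - 1)) *\<^sub>R sgn x"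
    unfolding u p_def by (rule grad_eqI)
  also have "norm x powr (- \<alpha> - 1) = p / n"
    using n by (simp add: p_def n_def powr_diff)
  also have "sgn x = (1 / n) *\<^sub>R x" by (simp add: sgn_div_norm n_def inverse_eq_divide)
  finally have g: "grad u x = p *\<^sub>R (grad \<phi> x - (\<alpha> * \<phi> x / n\<^sup>2) *\<^sub>R x)"
    by (simp add: algebra_simps power2_eq_square)
  have p2: "p\<^sup>2 = weight x" unfolding p_def \<alpha> by (rule norm_powr_hardy_exp)
  have w: "weight x / n\<^sup>2 = 1 / n ^ DIM('a)"
    using n by (simp add: weight_eq[OF N] n_def[symmetric])
  have gf: "grad (\<lambda>x. \<phi> x * \<phi> x) x = (2 * \<phi> x) *\<^sub>R grad \<phi> x"
    using fun_cong[OF grad_C1_mult[OF \<phi> \<phi>], of x] by (simp add: scaleR_add_left[symmetric])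
  have "(norm (grad u x))\<^sup>2 = p\<^sup>2 * ((norm (grad \<phi> x))\<^sup>2 - 2 * (\<alpha> * \<phi> x / n\<^sup>2) * (x \<bullet> grad \<phi> x) + (\<alpha> * \<phi> x / n\<^sup>2)\<^sup>2 * n\<^sup>2)"
  proof -
    have "(norm (a - c *\<^sub>R x))\<^sup>2 = (norm a)\<^sup>2 - 2 * c * (x \<bullet> a) + c\<^sup>2 * n\<^sup>2" for a c
      unfolding n_def power2_norm_eq_inner by (simp add: inner_diff inner_commute power2_eq_square algebra_simps)
    then show ?thesis unfolding g by (simp add: power_mult_distrib)
  qed
  also have "\<dots> = weight x * (norm (grad \<phi> x))\<^sup>2 - \<alpha> * (weight x / n\<^sup>2 * (2 * \<phi> x * (x \<bullet> grad \<phi> x)))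
       + \<alpha>\<^sup>2 * (p\<^sup>2 * (\<phi> x)\<^sup>2 / n\<^sup>2)"
    unfolding p2 using n by (simp add: field_simps power2_eq_square)
  also have "p\<^sup>2 * (\<phi> x)\<^sup>2 = (u x)\<^sup>2" by (simp add: u p_def power_mult_distrib)
  finally show ?thesis unfolding w gf by (simp add: n_def)
qed

text \<open>\<open>W\<close> is the weighted gradient term, \<open>D\<close> the radial derivative,
  \<open>E\<close> the Hardy term \<open>u^2 / |x|^2\<close> in natural powers. \<open>E\<close>
  need not be integrable at the origin, so it is subtracted for fixed \<open>e\<close>;
  \<open>D\<close> has by then become a spherical mean, and only \<open>W\<close> needs an integral
  up to the origin.\<close>

lemma H_energy_core:
  "H_energy \<Omega> u = (LINT x|lborel. weight x * (norm (grad \<phi> x))\<^sup>2)"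
proof -
  note [measurable] = C1_measurable[OF \<phi>]
  let ?\<omega> = "measure lebesgue (ball (0::'a) 1)"
  define f where "f x = \<phi> x * \<phi> x" for x
  have f: "f \<in> C1_functions \<Omega>" using C1_mult[OF \<phi> \<phi>] by (simp add: f_def[abs_def])
  note [measurable] = C1_measurable[OF f]
  define W where "W x = weight x * (norm (grad \<phi> x))\<^sup>2" for x
  define D where "D x = norm x ^ 0 / norm x ^ DIM('a) * (real 0 * f x + x \<bullet> grad f x)" for x
  define E where "E x = norm x ^ 2 / norm x ^ DIM('a) * (\<phi> x)\<^sup>2 / (norm x)\<^sup>2" for x
  have W: "integrable lborel W" unfolding W_def[abs_def] by (rule C1_weighted_integrable(2)[OF N \<phi>])
  have W0: "W 0 = 0" by (simp add: W_def weight_def)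
  obtain R where R: "\<And>x. R \<le> norm x \<Longrightarrow> \<phi> x = 0" using C1_bounds[OF \<phi>] by metis
  obtain R' where R': "\<And>x. R' \<le> norm x \<Longrightarrow> f x = 0" "\<And>x. R' \<le> norm x \<Longrightarrow> grad f x = 0"
    using C1_bounds[OF f] by metis
  have uE: "(u x)\<^sup>2 / (norm x)\<^sup>2 = E x" if "x \<noteq> 0" for x
  proof -
    have "(norm x powr (- \<alpha>))\<^sup>2 = weight x" unfolding \<alpha> by (rule norm_powr_hardy_exp)
    then show ?thesis by (simp add: E_def u power_mult_distrib weight_eq[OF N])
  qed
  have gE: "(norm (grad u x))\<^sup>2 = W x - \<alpha> * D x + \<alpha>\<^sup>2 * E x" if "x \<noteq> 0" for x
    using norm_grad_core[OF that] uE[OF that] by (simp add: W_def D_def f_def[abs_def])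
  have z: "W x = 0" "D x = 0" "E x = 0" if "x \<notin> \<Omega>" for x
    using C1_zero_outside_domain[OF \<phi> that] C1_zero_outside_domain[OF f that]
    by (simp_all add: W_def D_def E_def)
  let ?I = "\<lambda>e. indicator {x::'a. e \<le> norm x} :: 'a \<Rightarrow> real"
  have eq: "(LINT x:(\<Omega> - ball 0 e)|lebesgue. (norm (grad u x))\<^sup>2)
      - \<alpha>\<^sup>2 * (LINT x:(\<Omega> - ball 0 e)|lebesgue. (u x)\<^sup>2 / (norm x)\<^sup>2)
      = (LINT x|lborel. ?I e x * W x) + \<alpha> * real DIM('a) * (LINT s|direction_measure. f (e *\<^sub>R s))" if e: "e > 0" for e
  proof -
    have iW: "integrable lborel (\<lambda>x. ?I e x * W x)"
      by (rule Bochner_Integration.integrable_bound[OF W]) (use W in \<open>auto simp: indicator_def\<close>)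
    have iD: "integrable lborel (\<lambda>x. ?I e x * D x)" unfolding D_def
      by (rule integrable_outside_ball[OF e, where R=R'])
        (auto intro!: continuous_intros C1_continuous[OF f] C1_continuous_grad[OF f] simp: R')
    have "continuous_on (- {0}) E"
      unfolding E_def[abs_def] by (intro continuous_intros C1_continuous[OF \<phi>]) auto
    then have iE: "integrable lborel (\<lambda>x. ?I e x * E x)"
      by (rule integrable_outside_ball[OF e, where R=R]) (simp add: E_def R)
    have [measurable]: "W \<in> borel_measurable borel" "D \<in> borel_measurable borel" "E \<in> borel_measurable borel"
      unfolding W_def[abs_def] D_def[abs_def] E_def[abs_def] by measurable
    have "(LINT x:(\<Omega> - ball 0 e)|lebesgue. (norm (grad u x))\<^sup>2) = (LINT x|lborel. ?I e x * (W x - \<alpha> * D x + \<alpha>\<^sup>2 * E x))"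
    proof (rule set_integral_lebesgue_eq_lborel)
      show "(norm (grad u x))\<^sup>2 = ?I e x * (W x - \<alpha> * D x + \<alpha>\<^sup>2 * E x)" if "x \<in> \<Omega> - ball 0 e" for x
        using that gE[of x] e by (cases "x = 0") auto
      show "?I e x * (W x - \<alpha> * D x + \<alpha>\<^sup>2 * E x) = 0" if "x \<notin> \<Omega> - ball 0 e" for x
        using that z[of x] by (auto simp: indicator_def)
    qed measurable
    also have "\<dots> = (LINT x|lborel. ?I e x * W x - \<alpha> * (?I e x * D x) + \<alpha>\<^sup>2 * (?I e x * E x))"
      by (simp add: algebra_simps)
    also have "\<dots> = (LINT x|lborel. ?I e x * W x) - \<alpha> * (LINT x|lborel. ?I e x * D x) + \<alpha>\<^sup>2 * (LINT x|lborel. ?I e x * E x)"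
      using iW iD iE by simp
    also have "(LINT x|lborel. ?I e x * D x) = - real DIM('a) * (LINT s|direction_measure. f (e *\<^sub>R s))"
      unfolding D_def integral_radial_derivative[OF f e] by simp
    also have "(LINT x|lborel. ?I e x * E x) = (LINT x:(\<Omega> - ball 0 e)|lebesgue. (u x)\<^sup>2 / (norm x)\<^sup>2)"
    proof (rule set_integral_lebesgue_eq_lborel[symmetric])
      show "(u x)\<^sup>2 / (norm x)\<^sup>2 = ?I e x * E x" if "x \<in> \<Omega> - ball 0 e" for x
        using that uE[of x] e by (cases "x = 0") auto
      show "?I e x * E x = 0" if "x \<notin> \<Omega> - ball 0 e" for x
        using that z[of x] by (auto simp: indicator_def)
    qed measurable
    finally show ?thesis by simp
  qed
  have "((\<lambda>e. (LINT x|lborel. ?I e x * W x) + \<alpha> * real DIM('a) * (LINT s|direction_measure. f (e *\<^sub>R s)))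
      \<longlongrightarrow> (LINT x|lborel. W x) + \<alpha> * real DIM('a) * (f 0 * ?\<omega>)) (at_right 0)"
    by (intro tendsto_intros integral_outside_ball_tendsto[OF W W0] C1_spherical_mean_tendsto[OF f])
  moreover have "\<forall>\<^sub>F e in at_right 0. (LINT x:(\<Omega> - ball 0 e)|lebesgue. (norm (grad u x))\<^sup>2)
      - \<alpha>\<^sup>2 * (LINT x:(\<Omega> - ball 0 e)|lebesgue. (u x)\<^sup>2 / (norm x)\<^sup>2)
      = (LINT x|lborel. ?I e x * W x) + \<alpha> * real DIM('a) * (LINT s|direction_measure. f (e *\<^sub>R s))"
    using eventually_at_right_less[of "0::real"] by eventually_elim (rule eq)
  ultimately have "((\<lambda>e. (LINT x:(\<Omega> - ball 0 e)|lebesgue. (norm (grad u x))\<^sup>2)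
      - \<alpha>\<^sup>2 * (LINT x:(\<Omega> - ball 0 e)|lebesgue. (u x)\<^sup>2 / (norm x)\<^sup>2))
      \<longlongrightarrow> (LINT x|lborel. W x) + \<alpha> * real DIM('a) * (f 0 * ?\<omega>)) (at_right 0)"
    by (simp add: tendsto_cong)
  then have "Lim (at_right 0) (\<lambda>e. (LINT x:(\<Omega> - ball 0 e)|lebesgue. (norm (grad u x))\<^sup>2)
      - (hardy_exp TYPE('a))\<^sup>2 * (LINT x:(\<Omega> - ball 0 e)|lebesgue. (u x)\<^sup>2 / (norm x)\<^sup>2))
      = (LINT x|lborel. W x) + \<alpha> * real DIM('a) * (f 0 * ?\<omega>)"
    unfolding \<alpha>[symmetric] by (intro tendsto_Lim) auto
  then show ?thesis
    unfolding H_energy_def L_functional_core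
    by (simp add: W_def[abs_def] f_def \<alpha> hardy_exp_def power2_eq_square)
qed

lemma H_prenorm_core: "H_prenorm \<Omega> u = W_prenorm \<Omega> \<phi>"
  by (simp add: H_prenorm_def H_energy_core W_prenorm_eq[OF \<phi>])

end

section \<open>The completions\<close>

text \<open>Plays two parts: it is the factor \<open>|x|^(-a)\<close> of the substitution, and, its
  square being \<open>weight\<close>, multiplication by it turns weighted L2 norms into unweighted
  ones.\<close>

abbreviation sqrt_weight :: "'a::euclidean_space \<Rightarrow> real"
  where "sqrt_weight x \<equiv> norm x powr (- hardy_exp TYPE('a))"

context
  fixes \<Omega> :: "'a::euclidean_space set" and R :: real
  assumes N: "DIM('a) \<ge> 3" and op: "open \<Omega>" and R: "R > 0" "\<Omega> \<subseteq> ball 0 R"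
begin

lemma domain_sets: "\<Omega> \<in> sets lebesgue" using op by auto

lemma domain_measurable:
  "f \<in> borel_measurable borel \<Longrightarrow> f \<in> borel_measurable (lebesgue_on \<Omega>)"
  by (intro measurable_restrict_space1 measurable_completion) simp

lemma AE_domain: "AE x in lebesgue_on \<Omega>. x \<in> \<Omega> \<and> x \<noteq> 0"
proof -
  have "AE x in lebesgue. x \<noteq> (0::'a)" by (rule AE_completion[OF AE_lborel_singleton])
  then show ?thesis using domain_sets
    by (subst AE_restrict_space_iff) auto
qed

lemma integral_domain:
  fixes F :: "'a \<Rightarrow> real"
  assumes m: "F \<in> borel_measurable borel" and z: "\<And>x. x \<notin> \<Omega> \<Longrightarrow> F x = 0"
  shows "(LINT x|lebesgue_on \<Omega>. F x) = (LINT x|lborel. F x)"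
    and "integrable (lebesgue_on \<Omega>) F \<longleftrightarrow> integrable lborel F"
proof -
  have e: "(\<lambda>x. indicator \<Omega> x *\<^sub>R F x) = F" using z by (auto simp: indicator_def fun_eq_iff)
  have \<Omega>: "\<Omega> \<inter> space lebesgue \<in> sets lebesgue" using domain_sets by simp
  show "(LINT x|lebesgue_on \<Omega>. F x) = (LINT x|lborel. F x)"
    unfolding integral_restrict_space[OF \<Omega>] e using m by (simp add: integral_completion)
  show "integrable (lebesgue_on \<Omega>) F \<longleftrightarrow> integrable lborel F"
    unfolding integrable_restrict_space[OF \<Omega>] e using m by (simp add: integrable_completion)
qed

lemma norm_powr_hardy_exp_le:
  assumes "x \<in> \<Omega>" shows "norm x powr hardy_exp TYPE('a) \<le> R powr hardy_exp TYPE('a)"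
  using assms R N by (intro powr_mono2) (auto simp: hardy_exp_def)

lemma sqrt_weight_cancel: "x \<noteq> 0 \<Longrightarrow> norm x powr hardy_exp TYPE('a) * sqrt_weight x = 1"
  for x :: 'a by (simp add: powr_minus)

lemma square_integrable_C1:
  assumes \<phi>: "\<phi> \<in> C1_functions \<Omega>"
  shows "square_integrable (lebesgue_on \<Omega>) (\<lambda>x. sqrt_weight x *\<^sub>R grad \<phi> x)"
    and "square_integrable (lebesgue_on \<Omega>) (\<lambda>x. sqrt_weight x * \<phi> x)"
    and "(LINT x|lebesgue_on \<Omega>. (norm (sqrt_weight x *\<^sub>R grad \<phi> x))\<^sup>2) = (W_prenorm \<Omega> \<phi>)\<^sup>2"
    and "(LINT x|lebesgue_on \<Omega>. (norm (sqrt_weight x * \<phi> x))\<^sup>2) \<le> R\<^sup>2 * (W_prenorm \<Omega> \<phi>)\<^sup>2"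
proof -
  note [measurable] = C1_measurable[OF \<phi>]
  have e1: "(norm (sqrt_weight x *\<^sub>R grad \<phi> x))\<^sup>2 = weight x * (norm (grad \<phi> x))\<^sup>2" for x
    by (simp add: power_mult_distrib norm_powr_hardy_exp)
  have e2: "(norm (sqrt_weight x * \<phi> x))\<^sup>2 = weight x * (\<phi> x)\<^sup>2" for x
    by (simp add: power_mult_distrib norm_powr_hardy_exp norm_mult)
  note i = C1_weighted_integrable[OF N \<phi>]
  have W: "(W_prenorm \<Omega> \<phi>)\<^sup>2 = (LINT x|lborel. weight x * (norm (grad \<phi> x))\<^sup>2)"
    by (simp add: W_prenorm_eq[OF \<phi>] integral_nonneg_AE weight_nonneg)
  have d1: "(LINT x|lebesgue_on \<Omega>. weight x * (norm (grad \<phi> x))\<^sup>2) = (LINT x|lborel. weight x * (norm (grad \<phi> x))\<^sup>2)"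
    "integrable (lebesgue_on \<Omega>) (\<lambda>x. weight x * (norm (grad \<phi> x))\<^sup>2)"
    using integral_domain[of "\<lambda>x. weight x * (norm (grad \<phi> x))\<^sup>2"] i C1_zero_outside_domain[OF \<phi>] by auto
  have d2: "(LINT x|lebesgue_on \<Omega>. weight x * (\<phi> x)\<^sup>2) = (LINT x|lborel. weight x * (\<phi> x)\<^sup>2)"
    "integrable (lebesgue_on \<Omega>) (\<lambda>x. weight x * (\<phi> x)\<^sup>2)"
    using integral_domain[of "\<lambda>x. weight x * (\<phi> x)\<^sup>2"] i C1_zero_outside_domain[OF \<phi>] by auto
  have m1: "(\<lambda>x. sqrt_weight x *\<^sub>R grad \<phi> x) \<in> borel_measurable (lebesgue_on \<Omega>)"
    by (rule domain_measurable) measurable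
  have m2: "(\<lambda>x. sqrt_weight x * \<phi> x) \<in> borel_measurable (lebesgue_on \<Omega>)"
    by (rule domain_measurable) measurable
  show "square_integrable (lebesgue_on \<Omega>) (\<lambda>x. sqrt_weight x *\<^sub>R grad \<phi> x)"
    unfolding square_integrable_def e1 using d1 m1 by blast
  show "square_integrable (lebesgue_on \<Omega>) (\<lambda>x. sqrt_weight x * \<phi> x)"
    unfolding square_integrable_def e2 using d2 m2 by blast
  show "(LINT x|lebesgue_on \<Omega>. (norm (sqrt_weight x *\<^sub>R grad \<phi> x))\<^sup>2) = (W_prenorm \<Omega> \<phi>)\<^sup>2"
    unfolding e1 d1 W ..
  show "(LINT x|lebesgue_on \<Omega>. (norm (sqrt_weight x * \<phi> x))\<^sup>2) \<le> R\<^sup>2 * (W_prenorm \<Omega> \<phi>)\<^sup>2"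
    unfolding e2 d2 W by (rule weighted_Poincare[OF N \<phi> R(2)])
qed

text \<open>Weighted bounds imply unweighted ones, since \<open>1 \<le> R^a * |x|^(-a)\<close> at
  the points of the domain other than the origin.\<close>

lemma square_integrable_C1':
  assumes \<phi>: "\<phi> \<in> C1_functions \<Omega>"
  shows "square_integrable (lebesgue_on \<Omega>) \<phi>" "square_integrable (lebesgue_on \<Omega>) (grad \<phi>)"
proof -
  note m = domain_measurable[OF C1_measurable(1)[OF \<phi>]] domain_measurable[OF C1_measurable(2)[OF \<phi>]]
  have le: "a \<le> R powr hardy_exp TYPE('a) * (sqrt_weight x * a)" if "x \<in> \<Omega> \<and> x \<noteq> 0" "a \<ge> 0" for x a
  proof -
    have "a = (norm x powr hardy_exp TYPE('a) * sqrt_weight x) * a"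
      using sqrt_weight_cancel[of x] that by simp
    also have "\<dots> = norm x powr hardy_exp TYPE('a) * (sqrt_weight x * a)" by (rule mult.assoc)
    also have "\<dots> \<le> R powr hardy_exp TYPE('a) * (sqrt_weight x * a)"
      using that by (intro mult_right_mono norm_powr_hardy_exp_le) auto
    finally show ?thesis .
  qed
  show "square_integrable (lebesgue_on \<Omega>) \<phi>"
    by (rule square_integrable_bound[OF square_integrable_C1(2)[OF \<phi>] m(1), of "R powr hardy_exp TYPE('a)"],
        use AE_domain in eventually_elim) (simp add: abs_mult le)
  show "square_integrable (lebesgue_on \<Omega>) (grad \<phi>)"
    by (rule square_integrable_bound[OF square_integrable_C1(1)[OF \<phi>] m(2), of "R powr hardy_exp TYPE('a)"],
        use AE_domain in eventually_elim) (simp add: le)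
qed

text \<open>For the gradients the squared L2 distance equals the squared W distance, hence the
  constant 1; for the functions themselves it is the Poincare inequality that gives the constant
  \<open>R^2\<close>.\<close>

lemma L2_Cauchy_of_W_Cauchy:
  fixes \<phi> :: "nat \<Rightarrow> 'a \<Rightarrow> real"
  assumes \<phi>: "\<And>n. \<phi> n \<in> C1_functions \<Omega>"
    and C: "\<forall>e>0. \<exists>K. \<forall>m\<ge>K. \<forall>n\<ge>K. W_prenorm \<Omega> (\<lambda>x. \<phi> m x - \<phi> n x) < e" and e: "e > 0"
  shows "\<exists>K. \<forall>m\<ge>K. \<forall>n\<ge>K. (\<integral>\<^sup>+x. ennreal ((norm (sqrt_weight x *\<^sub>R grad (\<phi> m) x - sqrt_weight x *\<^sub>R grad (\<phi> n) x))\<^sup>2) \<partial>lebesgue_on \<Omega>) < ennreal e"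
    and "\<exists>K. \<forall>m\<ge>K. \<forall>n\<ge>K. (\<integral>\<^sup>+x. ennreal ((norm (sqrt_weight x * \<phi> m x - sqrt_weight x * \<phi> n x))\<^sup>2) \<partial>lebesgue_on \<Omega>) < ennreal e"
proof -
  note d = C1_diff[OF \<phi> \<phi>]
  have C': "\<exists>K. \<forall>m\<ge>K. \<forall>n\<ge>K. W_prenorm \<Omega> (\<lambda>x. \<phi> m x - \<phi> n x) < e" if "e > 0" for e
    using C that by blast
  have p: "0 \<le> W_prenorm \<Omega> (\<lambda>x. \<phi> m x - \<phi> n x)" for m n
    by (simp add: W_prenorm_eq[OF d] integral_nonneg_AE weight_nonneg)
  show "\<exists>K. \<forall>m\<ge>K. \<forall>n\<ge>K. (\<integral>\<^sup>+x. ennreal ((norm (sqrt_weight x *\<^sub>R grad (\<phi> m) x - sqrt_weight x *\<^sub>R grad (\<phi> n) x))\<^sup>2) \<partial>lebesgue_on \<Omega>) < ennreal e"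
  proof (rule L2_Cauchy_transfer[where q="\<lambda>m n. W_prenorm \<Omega> (\<lambda>x. \<phi> m x - \<phi> n x)" and c=1, OF C' p _ _ e])
    show "(\<integral>\<^sup>+x. ennreal ((norm (sqrt_weight x *\<^sub>R grad (\<phi> m) x - sqrt_weight x *\<^sub>R grad (\<phi> n) x))\<^sup>2) \<partial>lebesgue_on \<Omega>)
        \<le> ennreal (1 * (W_prenorm \<Omega> (\<lambda>x. \<phi> m x - \<phi> n x))\<^sup>2)" for m n
      using square_integrable_nn_integral[OF square_integrable_C1(1)[OF d[of m n]]] square_integrable_C1(3)[OF d[of m n]]
      by (simp add: grad_C1_diff[OF \<phi> \<phi>] scaleR_diff_right)
  qed auto
  show "\<exists>K. \<forall>m\<ge>K. \<forall>n\<ge>K. (\<integral>\<^sup>+x. ennreal ((norm (sqrt_weight x * \<phi> m x - sqrt_weight x * \<phi> n x))\<^sup>2) \<partial>lebesgue_on \<Omega>) < ennreal e"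
  proof (rule L2_Cauchy_transfer[where q="\<lambda>m n. W_prenorm \<Omega> (\<lambda>x. \<phi> m x - \<phi> n x)" and c="R\<^sup>2", OF C' p _ _ e])
    show "(\<integral>\<^sup>+x. ennreal ((norm (sqrt_weight x * \<phi> m x - sqrt_weight x * \<phi> n x))\<^sup>2) \<partial>lebesgue_on \<Omega>)
        \<le> ennreal (R\<^sup>2 * (W_prenorm \<Omega> (\<lambda>x. \<phi> m x - \<phi> n x))\<^sup>2)" for m n
      using square_integrable_nn_integral[OF square_integrable_C1(2)[OF d[of m n]]]
        ennreal_leI[OF square_integrable_C1(4)[OF d[of m n]]]
      by (simp only: right_diff_distrib)
  qed auto
qed

section \<open>Transfer of representing sequences between the two spaces\<close>

lemma represents_iff_L2:
  "represents \<Omega> D nrm f u \<longleftrightarrow> (\<forall>n. f n \<in> D) \<and>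
    (\<forall>e>0. \<exists>M. \<forall>m\<ge>M. \<forall>n\<ge>M. nrm (\<lambda>x. f m x - f n x) < e) \<and>
    u \<in> borel_measurable (lebesgue_on \<Omega>) \<and> L2_tendsto (lebesgue_on \<Omega>) f u"
  by (simp add: represents_def L2_tendsto_def)

lemma sqrt_weight_domain_measurable: "sqrt_weight \<in> borel_measurable (lebesgue_on \<Omega>)"
  by (rule domain_measurable) measurable

text \<open>The direction with the unbounded factor. L2 convergence of \<open>\<phi> n\<close> to
  \<open>v\<close> only supplies a subsequence converging almost everywhere; multiplied by
  \<open>sqrt_weight\<close> it converges pointwise to \<open>u\<close>. The L2 Cauchy property of
  the products, from Poincare, upgrades this to L2 convergence of the whole sequence.\<close>

lemma represents_H_of_W:
  assumes v: "v = (\<lambda>x. norm x powr hardy_exp TYPE('a) * u x)"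
    and r: "represents \<Omega> (test_functions \<Omega>) (W_prenorm \<Omega>) \<phi> v"
  shows "represents \<Omega> (H_core \<Omega>) (H_prenorm \<Omega>) (\<lambda>n x. sqrt_weight x * \<phi> n x) u"
    and "H_prenorm \<Omega> (\<lambda>x. sqrt_weight x * \<phi> n x) = W_prenorm \<Omega> (\<phi> n)"
proof -
  note sqrt_weight_domain_measurable [measurable]
  have T: "\<And>n. \<phi> n \<in> test_functions \<Omega>"
    and C: "\<forall>e>0. \<exists>M. \<forall>m\<ge>M. \<forall>n\<ge>M. W_prenorm \<Omega> (\<lambda>x. \<phi> m x - \<phi> n x) < e"
    and vm [measurable]: "v \<in> borel_measurable (lebesgue_on \<Omega>)" and L: "L2_tendsto (lebesgue_on \<Omega>) \<phi> v"
    using r by (auto simp: represents_iff_L2)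
  have \<phi>: "\<phi> n \<in> C1_functions \<Omega>" for n using T test_functions_subset_C1 by blast
  have uv: "u x = sqrt_weight x * v x" if "x \<noteq> 0" for x
  proof -
    have "sqrt_weight x * v x = (norm x powr hardy_exp TYPE('a) * sqrt_weight x) * u x"
      unfolding v by (simp only: mult_ac)
    then show ?thesis by (simp only: sqrt_weight_cancel[OF that] mult_1_left)
  qed
  \<comment> \<open>The value \<open>u 0\<close> cannot be recovered from \<open>v\<close>, since
    \<open>v 0 = 0\<close> in any case. So \<open>u\<close> is written as
    \<open>sqrt_weight x * v x\<close> with one point redefined.\<close>
  have um: "u \<in> borel_measurable (lebesgue_on \<Omega>)"
  proof -
    have "{0::'a} \<inter> \<Omega> \<in> sets (lebesgue_on \<Omega>)"
      by (intro sets_restrict_space_iff[THEN iffD2]) (auto simp: domain_sets)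
    then have "(\<lambda>x. if x \<in> {0} \<inter> \<Omega> then u 0 else sqrt_weight x * v x) \<in> borel_measurable (lebesgue_on \<Omega>)"
      by (intro measurable_If_set) auto
    then show ?thesis
      by (rule measurable_cong[THEN iffD1, rotated]) (use uv in auto)
  qed
  have "L2_tendsto (lebesgue_on \<Omega>) (\<lambda>n x. sqrt_weight x * \<phi> n x) u"
  proof -
    have \<phi>s: "square_integrable (lebesgue_on \<Omega>) (\<phi> n)" for n by (rule square_integrable_C1'(1)[OF \<phi>])
    obtain s where s: "strict_mono (s::nat\<Rightarrow>nat)" "AE x in lebesgue_on \<Omega>. (\<lambda>k. \<phi> (s k) x) \<longlonglongrightarrow> v x"
      using L2_tendsto_AE_subseq[OF \<phi>s L2_tendsto_square_integrable[OF L \<phi>s vm] L] by blast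
    show ?thesis
    proof (rule L2_tendsto_if_Cauchy_AE[OF _ um _ s(1)])
      show "(\<lambda>x. sqrt_weight x * \<phi> n x) \<in> borel_measurable (lebesgue_on \<Omega>)" for n
        using square_integrable_C1(2)[OF \<phi>] by (auto simp: square_integrable_def)
      show "AE x in lebesgue_on \<Omega>. (\<lambda>k. sqrt_weight x * \<phi> (s k) x) \<longlonglongrightarrow> u x"
        using s(2) AE_domain by eventually_elim (simp add: uv tendsto_mult_left)
    qed (rule L2_Cauchy_of_W_Cauchy(2)[OF \<phi> C])
  qed
  moreover have "(\<lambda>x. sqrt_weight x * \<phi> n x) \<in> H_core \<Omega>" for n using T by (auto simp: H_core_def)
  moreover have "H_prenorm \<Omega> (\<lambda>x. sqrt_weight x * \<phi> m x - sqrt_weight x * \<phi> n x)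
      = W_prenorm \<Omega> (\<lambda>x. \<phi> m x - \<phi> n x)" for m n
    by (rule H_prenorm_core[OF N C1_diff[OF \<phi> \<phi>] refl]) (simp add: right_diff_distrib)
  ultimately show "represents \<Omega> (H_core \<Omega>) (H_prenorm \<Omega>) (\<lambda>n x. sqrt_weight x * \<phi> n x) u"
    using C um by (simp add: represents_iff_L2)
  show "H_prenorm \<Omega> (\<lambda>x. sqrt_weight x * \<phi> n x) = W_prenorm \<Omega> (\<phi> n)"
    by (rule H_prenorm_core[OF N \<phi> refl refl])
qed

text \<open>The direction with the bounded factor: the error of \<open>\<phi> n\<close> is
  \<open>|x|^a\<close> times the error of \<open>f n\<close>, hence at most \<open>R^a\<close> times
  it.\<close>

lemma represents_W_of_H:
  assumes v: "v = (\<lambda>x. norm x powr hardy_exp TYPE('a) * u x)"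
    and r: "represents \<Omega> (H_core \<Omega>) (H_prenorm \<Omega>) f u"
  obtains \<phi> where "represents \<Omega> (test_functions \<Omega>) (W_prenorm \<Omega>) \<phi> v"
    "\<And>n. H_prenorm \<Omega> (f n) = W_prenorm \<Omega> (\<phi> n)"
proof -
  have fH: "\<And>n. f n \<in> H_core \<Omega>"
    and C: "\<forall>e>0. \<exists>M. \<forall>m\<ge>M. \<forall>n\<ge>M. H_prenorm \<Omega> (\<lambda>x. f m x - f n x) < e"
    and um [measurable]: "u \<in> borel_measurable (lebesgue_on \<Omega>)" and L: "L2_tendsto (lebesgue_on \<Omega>) f u"
    using r by (auto simp: represents_iff_L2)
  have "\<forall>n. \<exists>\<phi>. \<phi> \<in> test_functions \<Omega> \<and> f n = (\<lambda>x. sqrt_weight x * \<phi> x)"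
    using fH by (auto simp: H_core_def)
  then obtain \<phi> where T: "\<And>n. \<phi> n \<in> test_functions \<Omega>" and f: "\<And>n. f n = (\<lambda>x. sqrt_weight x * \<phi> n x)"
    by metis
  have \<phi>: "\<phi> n \<in> C1_functions \<Omega>" for n using T test_functions_subset_C1 by blast
  have "H_prenorm \<Omega> (\<lambda>x. f m x - f n x) = W_prenorm \<Omega> (\<lambda>x. \<phi> m x - \<phi> n x)" for m n
    by (rule H_prenorm_core[OF N C1_diff[OF \<phi> \<phi>] refl]) (simp add: f right_diff_distrib)
  moreover have [measurable]: "(\<lambda>x. norm x powr hardy_exp TYPE('a)) \<in> borel_measurable (lebesgue_on \<Omega>)"
    by (rule domain_measurable) measurable
  moreover have "v \<in> borel_measurable (lebesgue_on \<Omega>)" unfolding v by measurable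
  moreover have "L2_tendsto (lebesgue_on \<Omega>) \<phi> v"
  proof (rule L2_tendsto_bound[OF L _ um])
    show "f n \<in> borel_measurable (lebesgue_on \<Omega>)" for n
      using square_integrable_C1(2)[OF \<phi>] by (auto simp: f square_integrable_def)
    show "AE x in lebesgue_on \<Omega>. norm (\<phi> n x - v x) \<le> R powr hardy_exp TYPE('a) * norm (f n x - u x)" for n
      using AE_domain
    proof eventually_elim
      fix x assume x: "x \<in> \<Omega> \<and> x \<noteq> 0"
      have "\<phi> n x - v x = norm x powr hardy_exp TYPE('a) * (f n x - u x)"
        using sqrt_weight_cancel[of x] x by (simp add: f v right_diff_distrib mult.assoc[symmetric])
      then show "norm (\<phi> n x - v x) \<le> R powr hardy_exp TYPE('a) * norm (f n x - u x)"
        using x by (simp add: abs_mult mult_right_mono norm_powr_hardy_exp_le)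
    qed
  qed
  ultimately have "represents \<Omega> (test_functions \<Omega>) (W_prenorm \<Omega>) \<phi> v"
    using C T by (simp add: represents_iff_L2)
  moreover have "H_prenorm \<Omega> (f n) = W_prenorm \<Omega> (\<phi> n)" for n
    by (rule H_prenorm_core[OF N \<phi> refl f])
  ultimately show ?thesis by (rule that)
qed

lemma H_space_iff_W_space:
  assumes v: "v = (\<lambda>x. norm x powr hardy_exp TYPE('a) * u x)"
  shows "u \<in> H_space \<Omega> \<longleftrightarrow> v \<in> W_space \<Omega>"
  unfolding H_space_def W_space_def completion_of_def
proof (intro iffI; clarsimp)
  fix f assume "represents \<Omega> (H_core \<Omega>) (H_prenorm \<Omega>) f u"
  from represents_W_of_H[OF v this] show "\<exists>f. represents \<Omega> (test_functions \<Omega>) (W_prenorm \<Omega>) f v" by blast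
next
  fix f assume "represents \<Omega> (test_functions \<Omega>) (W_prenorm \<Omega>) f v"
  from represents_H_of_W(1)[OF v this] show "\<exists>f. represents \<Omega> (H_core \<Omega>) (H_prenorm \<Omega>) f u" by blast
qed

text \<open>The same numbers are limits of norms along representing sequences in both spaces, so the
  two \<open>THE\<close> terms coincide even before existence and uniqueness of such a limit are
  known.\<close>

lemma H_norm_eq_W_norm:
  assumes v: "v = (\<lambda>x. norm x powr hardy_exp TYPE('a) * u x)"
  shows "H_norm \<Omega> u = W_norm \<Omega> v"
proof -
  have "(\<exists>f. represents \<Omega> (H_core \<Omega>) (H_prenorm \<Omega>) f u \<and> (\<lambda>n. H_prenorm \<Omega> (f n)) \<longlonglongrightarrow> r) \<longleftrightarrow>
    (\<exists>\<phi>. represents \<Omega> (test_functions \<Omega>) (W_prenorm \<Omega>) \<phi> v \<and> (\<lambda>n. W_prenorm \<Omega> (\<phi> n)) \<longlonglongrightarrow> r)" (is "?l \<longleftrightarrow> ?r") for r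
  proof
    assume ?l
    then obtain f where f: "represents \<Omega> (H_core \<Omega>) (H_prenorm \<Omega>) f u" "(\<lambda>n. H_prenorm \<Omega> (f n)) \<longlonglongrightarrow> r" by blast
    obtain \<phi> where "represents \<Omega> (test_functions \<Omega>) (W_prenorm \<Omega>) \<phi> v" "\<And>n. H_prenorm \<Omega> (f n) = W_prenorm \<Omega> (\<phi> n)"
      using represents_W_of_H[OF v f(1)] by blast
    with f(2) show ?r by (intro exI[of _ \<phi>]) simp
  next
    assume ?r
    then obtain \<phi> where \<phi>: "represents \<Omega> (test_functions \<Omega>) (W_prenorm \<Omega>) \<phi> v" "(\<lambda>n. W_prenorm \<Omega> (\<phi> n)) \<longlonglongrightarrow> r" by blast
    then show ?l
      using represents_H_of_W[OF v \<phi>(1)] by (intro exI[of _ "\<lambda>n x. sqrt_weight x * \<phi> n x"]) simp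
  qed
  then show ?thesis unfolding H_norm_def W_norm_def completion_norm_def by simp
qed

section \<open>Limit gradients and the value of the norm\<close>

text \<open>The product is again \<open>C1\<close> with compact support in the domain, so its
  directional derivative has integral 0; the product rule splits that integral in two.\<close>

lemma C1_integration_by_parts:
  assumes \<phi>: "\<phi> \<in> C1_functions \<Omega>" and \<eta>: "\<eta> \<in> C1_functions \<Omega>"
  shows "(LINT x|lebesgue_on \<Omega>. \<phi> x * (grad \<eta> x \<bullet> b)) = - (LINT x|lebesgue_on \<Omega>. (grad \<phi> x \<bullet> b) * \<eta> x)"
proof -
  note [measurable] = C1_measurable[OF \<phi>] C1_measurable[OF \<eta>]
  note si = square_integrable_C1'[OF \<phi>] square_integrable_C1'[OF \<eta>]
  have i: "integrable (lebesgue_on \<Omega>) (\<lambda>x. \<phi> x * (grad \<eta> x \<bullet> b))"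
    "integrable (lebesgue_on \<Omega>) (\<lambda>x. (grad \<phi> x \<bullet> b) * \<eta> x)"
    using square_integrable_inner[OF si(1) square_integrable_inner_const[OF si(4)]]
      square_integrable_inner[OF square_integrable_inner_const[OF si(2)] si(3)] by simp_all
  have "(LINT x|lebesgue_on \<Omega>. \<phi> x * (grad \<eta> x \<bullet> b)) + (LINT x|lebesgue_on \<Omega>. (grad \<phi> x \<bullet> b) * \<eta> x)
      = (LINT x|lebesgue_on \<Omega>. grad (\<lambda>x. \<phi> x * \<eta> x) x \<bullet> b)"
    unfolding grad_C1_mult[OF \<phi> \<eta>] using i by (simp add: inner_add_left mult.commute)
  also have "\<dots> = (LINT x|lborel. grad (\<lambda>x. \<phi> x * \<eta> x) x \<bullet> b)"
    by (rule integral_domain)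
      (use C1_measurable(2)[OF C1_mult[OF \<phi> \<eta>]] C1_zero_outside_domain(2)[OF C1_mult[OF \<phi> \<eta>]] in auto)
  also have "\<dots> = 0" by (rule integral_partial_derivative_eq_0[OF C1_mult[OF \<phi> \<eta>]])
  finally show ?thesis by simp
qed

text \<open>Completeness is applied to the weighted gradients, and the weight is then removed from
  the limit. Integration by parts is stated for \<open>C1\<close> functions \<open>\<eta>\<close>, a
  form that applies directly to partial derivatives of test functions.\<close>

lemma represents_W_gradient:
  assumes r: "represents \<Omega> (test_functions \<Omega>) (W_prenorm \<Omega>) \<phi> v"
  obtains g where "square_integrable (lebesgue_on \<Omega>) v" "square_integrable (lebesgue_on \<Omega>) g"
    "square_integrable (lebesgue_on \<Omega>) (\<lambda>x. sqrt_weight x *\<^sub>R g x)"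
    "L2_tendsto (lebesgue_on \<Omega>) (\<lambda>n. grad (\<phi> n)) g"
    "(\<lambda>n. W_prenorm \<Omega> (\<phi> n)) \<longlonglongrightarrow> sqrt (LINT x|lebesgue_on \<Omega>. (norm (sqrt_weight x *\<^sub>R g x))\<^sup>2)"
    "\<forall>\<eta>\<in>C1_functions \<Omega>. \<forall>b.
      (LINT x|lebesgue_on \<Omega>. v x * (grad \<eta> x \<bullet> b)) = - (LINT x|lebesgue_on \<Omega>. (g x \<bullet> b) * \<eta> x)"
proof -
  let ?M = "lebesgue_on \<Omega>"
  note sqrt_weight_domain_measurable [measurable]
  have T: "\<And>n. \<phi> n \<in> test_functions \<Omega>"
    and C: "\<forall>e>0. \<exists>M. \<forall>m\<ge>M. \<forall>n\<ge>M. W_prenorm \<Omega> (\<lambda>x. \<phi> m x - \<phi> n x) < e"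
    and vm [measurable]: "v \<in> borel_measurable ?M" and L: "L2_tendsto ?M \<phi> v"
    using r by (auto simp: represents_iff_L2)
  have \<phi>: "\<phi> n \<in> C1_functions \<Omega>" for n using T test_functions_subset_C1 by blast
  define F where "F n x = sqrt_weight x *\<^sub>R grad (\<phi> n) x" for n x
  have Fs: "square_integrable ?M (F n)" for n
    unfolding F_def by (rule square_integrable_C1(1)[OF \<phi>])
  then have Fm: "F n \<in> borel_measurable ?M" for n by (simp add: square_integrable_def)
  obtain G where Gm: "G \<in> borel_measurable ?M" and FG: "L2_tendsto ?M F G"
    using L2_complete[OF Fm L2_Cauchy_of_W_Cauchy(1)[OF \<phi> C, folded F_def]] by blast
  have Gs: "square_integrable ?M G" by (rule L2_tendsto_square_integrable[OF FG Fs Gm])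
  \<comment> \<open>Multiplication by the bounded \<open>|x|^a\<close> undoes the weight, so
    \<open>g\<close> is square integrable both with and without it.\<close>
  define g where "g x = norm x powr hardy_exp TYPE('a) *\<^sub>R G x" for x
  have [measurable]: "(\<lambda>x. norm x powr hardy_exp TYPE('a)) \<in> borel_measurable ?M"
    by (rule domain_measurable) measurable
  have gm [measurable]: "g \<in> borel_measurable ?M" unfolding g_def[abs_def] using Gm by measurable
  have gG: "sqrt_weight x *\<^sub>R g x = G x" if "x \<noteq> 0" for x
    using sqrt_weight_cancel[OF that] by (simp add: g_def mult.commute)
  have \<phi>F: "grad (\<phi> n) x = norm x powr hardy_exp TYPE('a) *\<^sub>R F n x" if "x \<noteq> 0" for n x
    using sqrt_weight_cancel[OF that] by (simp add: F_def)
  have vs: "square_integrable ?M v"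
    by (rule L2_tendsto_square_integrable[OF L square_integrable_C1'(1)[OF \<phi>] vm])
  have gs: "square_integrable ?M g"
    by (rule square_integrable_bound[OF Gs gm, of "R powr hardy_exp TYPE('a)"], use AE_domain in eventually_elim)
      (simp add: g_def mult_right_mono norm_powr_hardy_exp_le)
  have wgs: "square_integrable ?M (\<lambda>x. sqrt_weight x *\<^sub>R g x)"
  proof (rule square_integrable_bound[OF Gs])
    show "AE x in ?M. norm (sqrt_weight x *\<^sub>R g x) \<le> 1 * norm (G x)"
      using AE_domain
    proof eventually_elim
      fix x assume "x \<in> \<Omega> \<and> x \<noteq> 0"
      then have e: "sqrt_weight x *\<^sub>R g x = G x" using gG by blast
      show "norm (sqrt_weight x *\<^sub>R g x) \<le> 1 * norm (G x)" unfolding e by simp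
    qed
  qed measurable
  have Lg: "L2_tendsto ?M (\<lambda>n. grad (\<phi> n)) g"
  proof (rule L2_tendsto_bound[OF FG Fm Gm])
    show "AE x in ?M. norm (grad (\<phi> n) x - g x) \<le> R powr hardy_exp TYPE('a) * norm (F n x - G x)" for n
      using AE_domain
    proof eventually_elim
      fix x assume x: "x \<in> \<Omega> \<and> x \<noteq> 0"
      then have "grad (\<phi> n) x - g x = norm x powr hardy_exp TYPE('a) *\<^sub>R (F n x - G x)"
        by (simp add: \<phi>F g_def scaleR_diff_right)
      then show "norm (grad (\<phi> n) x - g x) \<le> R powr hardy_exp TYPE('a) * norm (F n x - G x)"
        using x by (simp add: mult_right_mono norm_powr_hardy_exp_le)
    qed
  qed
  \<comment> \<open>Squared norms are inner products of \<open>F n\<close> with itself, so they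
    converge by \<open>L2_tendsto_inner\<close> with both sequences equal.\<close>
  have W: "(\<lambda>n. W_prenorm \<Omega> (\<phi> n)) \<longlonglongrightarrow> sqrt (LINT x|?M. (norm (sqrt_weight x *\<^sub>R g x))\<^sup>2)"
  proof -
    have "(\<lambda>n. LINT x|?M. F n x \<bullet> F n x) \<longlonglongrightarrow> (LINT x|?M. G x \<bullet> G x)"
      by (rule L2_tendsto_inner[OF Fs Gs FG Fs Gs FG])
    moreover have "(LINT x|?M. F n x \<bullet> F n x) = (W_prenorm \<Omega> (\<phi> n))\<^sup>2" for n
      using square_integrable_C1(3)[OF \<phi>[of n]] unfolding F_def power2_norm_eq_inner .
    moreover have "(LINT x|?M. G x \<bullet> G x) = (LINT x|?M. (norm (sqrt_weight x *\<^sub>R g x))\<^sup>2)"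
      unfolding power2_norm_eq_inner
    proof (rule integral_cong_AE)
      show "AE x in ?M. G x \<bullet> G x = (sqrt_weight x *\<^sub>R g x) \<bullet> (sqrt_weight x *\<^sub>R g x)"
        using AE_domain
      proof eventually_elim
        fix x assume "x \<in> \<Omega> \<and> x \<noteq> 0"
        then have e: "sqrt_weight x *\<^sub>R g x = G x" using gG by blast
        show "G x \<bullet> G x = (sqrt_weight x *\<^sub>R g x) \<bullet> (sqrt_weight x *\<^sub>R g x)" unfolding e ..
      qed
    qed (use Gm in measurable)
    ultimately have "(\<lambda>n. (W_prenorm \<Omega> (\<phi> n))\<^sup>2) \<longlonglongrightarrow> (LINT x|?M. (norm (sqrt_weight x *\<^sub>R g x))\<^sup>2)" by simp
    from tendsto_real_sqrt[OF this] show ?thesis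
      by (simp add: W_prenorm_eq[OF \<phi>] integral_nonneg_AE weight_nonneg)
  qed
  have ibp: "(LINT x|?M. v x * (grad \<eta> x \<bullet> b)) = - (LINT x|?M. (g x \<bullet> b) * \<eta> x)" if \<eta>: "\<eta> \<in> C1_functions \<Omega>" for \<eta> b
  proof -
    note s\<eta> = square_integrable_C1'[OF \<eta>] and s\<phi> = square_integrable_C1'[OF \<phi>]
    have c: "L2_tendsto ?M (\<lambda>_. f) f" for f :: "'a \<Rightarrow> real" by (simp add: L2_tendsto_def)
    have gb: "L2_tendsto ?M (\<lambda>n x. grad (\<phi> n) x \<bullet> b) (\<lambda>x. g x \<bullet> b)"
    proof (rule L2_tendsto_bound[OF Lg])
      show "AE x in ?M. norm (grad (\<phi> n) x \<bullet> b - g x \<bullet> b) \<le> norm b * norm (grad (\<phi> n) x - g x)" for n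
        by (simp add: inner_diff_left[symmetric] Cauchy_Schwarz_ineq2 mult.commute[of "norm b"])
    qed (use s\<phi>(2) gm in \<open>auto simp: square_integrable_def\<close>)
    have "(\<lambda>n. LINT x|?M. \<phi> n x \<bullet> (grad \<eta> x \<bullet> b)) \<longlonglongrightarrow> (LINT x|?M. v x \<bullet> (grad \<eta> x \<bullet> b))"
      by (rule L2_tendsto_inner[OF s\<phi>(1) vs L square_integrable_inner_const[OF s\<eta>(2)] square_integrable_inner_const[OF s\<eta>(2)] c])
    moreover have "(\<lambda>n. - (LINT x|?M. (grad (\<phi> n) x \<bullet> b) \<bullet> \<eta> x)) \<longlonglongrightarrow> - (LINT x|?M. (g x \<bullet> b) \<bullet> \<eta> x)"
      by (rule tendsto_minus[OF L2_tendsto_inner[OF square_integrable_inner_const[OF s\<phi>(2)]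
              square_integrable_inner_const[OF gs] gb s\<eta>(1) s\<eta>(1) c]])
    ultimately show ?thesis
      unfolding inner_real_def C1_integration_by_parts[OF \<phi> \<eta>] by (rule LIMSEQ_unique)
  qed
  show ?thesis by (rule that[OF vs gs wgs Lg W]) (use ibp in blast)
qed

text \<open>The difference of two limit gradients is orthogonal to all \<open>C\<^sup>1\<close> functions, in particular
  to the gradients of the approximating sequences, hence to itself.\<close>

lemma limit_gradient_unique:
  assumes T: "\<And>n. \<phi> n \<in> test_functions \<Omega>" and T': "\<And>n. \<psi> n \<in> test_functions \<Omega>"
    and g: "square_integrable (lebesgue_on \<Omega>) g" and g': "square_integrable (lebesgue_on \<Omega>) g'"
    and L: "L2_tendsto (lebesgue_on \<Omega>) (\<lambda>n. grad (\<phi> n)) g"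
    and L': "L2_tendsto (lebesgue_on \<Omega>) (\<lambda>n. grad (\<psi> n)) g'"
    and eq: "\<And>\<eta> b. \<eta> \<in> C1_functions \<Omega> \<Longrightarrow>
      (LINT x|lebesgue_on \<Omega>. (g x \<bullet> b) * \<eta> x) = (LINT x|lebesgue_on \<Omega>. (g' x \<bullet> b) * \<eta> x)"
  shows "AE x in lebesgue_on \<Omega>. g x = g' x"
proof -
  let ?M = "lebesgue_on \<Omega>"
  define h where "h x = g x - g' x" for x
  have h: "square_integrable ?M h" unfolding h_def by (rule square_integrable_diff[OF g g'])
  have orth: "(LINT x|?M. h x \<bullet> G x) = 0"
    if G: "square_integrable ?M G" and T: "\<And>n. \<theta> n \<in> test_functions \<Omega>" and L: "L2_tendsto ?M (\<lambda>n. grad (\<theta> n)) G"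
    for G and \<theta> :: "nat \<Rightarrow> 'a \<Rightarrow> real"
  proof -
    have C: "\<theta> n \<in> C1_functions \<Omega>" for n using T test_functions_subset_C1 by blast
    have z: "(LINT x|?M. h x \<bullet> grad (\<theta> n) x) = 0" for n
    proof -
      \<comment> \<open>The inner product with \<open>grad (\<theta> n)\<close> is taken apart along
        the basis; the summand for \<open>b\<close> is the hypothesis \<open>eq\<close> with the
        partial derivative along the same \<open>b\<close> in place of
        \<open>\<eta>\<close>.\<close>
      have b0: "integrable ?M (\<lambda>x. (h x \<bullet> b) * (grad (\<theta> n) x \<bullet> b)) \<and> (LINT x|?M. (h x \<bullet> b) * (grad (\<theta> n) x \<bullet> b)) = 0" if b: "b \<in> Basis" for b
      proof -
        have \<eta>: "(\<lambda>x. grad (\<theta> n) x \<bullet> b) \<in> C1_functions \<Omega>" by (rule test_function_partial_derivative_C1[OF T b])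
        note s = square_integrable_C1'(1)[OF \<eta>]
        have i: "integrable ?M (\<lambda>x. (f x \<bullet> b) * (grad (\<theta> n) x \<bullet> b))" if "square_integrable ?M f" for f
          using square_integrable_inner[OF square_integrable_inner_const[OF that] s] by simp
        have "(LINT x|?M. (h x \<bullet> b) * (grad (\<theta> n) x \<bullet> b))
            = (LINT x|?M. (g x \<bullet> b) * (grad (\<theta> n) x \<bullet> b) - (g' x \<bullet> b) * (grad (\<theta> n) x \<bullet> b))"
          by (simp add: h_def inner_diff_left left_diff_distrib)
        also have "\<dots> = 0" using i[OF g] i[OF g'] eq[OF \<eta>] by simp
        finally show ?thesis using i[OF h] by simp
      qed
      have "(LINT x|?M. h x \<bullet> grad (\<theta> n) x) = (LINT x|?M. (\<Sum>b\<in>Basis. (h x \<bullet> b) * (grad (\<theta> n) x \<bullet> b)))"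
        by (simp only: euclidean_inner[symmetric])
      also have "\<dots> = 0" using b0 by (subst Bochner_Integration.integral_sum) auto
      finally show ?thesis .
    qed
    have "(\<lambda>n. LINT x|?M. h x \<bullet> grad (\<theta> n) x) \<longlonglongrightarrow> (LINT x|?M. h x \<bullet> G x)"
      by (rule L2_tendsto_inner[OF h h _ square_integrable_C1'(2)[OF C] G L]) (simp add: L2_tendsto_def)
    then show ?thesis by (simp add: z LIMSEQ_const_iff)
  qed
  have "(LINT x|?M. (norm (h x))\<^sup>2) = (LINT x|?M. h x \<bullet> g x - h x \<bullet> g' x)"
    by (simp add: power2_norm_eq_inner h_def inner_diff_right)
  also have "\<dots> = 0"
    using square_integrable_inner[OF h g] square_integrable_inner[OF h g'] orth[OF g T L] orth[OF g' T' L'] by simp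
  finally have "AE x in ?M. (norm (h x))\<^sup>2 = 0"
    using h by (subst (asm) integral_nonneg_eq_0_iff_AE) (auto simp: square_integrable_def)
  then show ?thesis by eventually_elim (simp add: h_def)
qed

text \<open>Any two sequences representing \<open>v\<close> have limit gradients that satisfy the
  same integration by parts formula against \<open>v\<close>. These agree almost everywhere, so the
  limit of the norms depends on \<open>v\<close> alone, and the \<open>THE\<close> in the norm is
  evaluated.\<close>

lemma W_norm_gradient:
  assumes v: "v \<in> W_space \<Omega>"
  shows "\<exists>g. has_weak_gradient \<Omega> v g \<and>
    has_bochner_integral (lebesgue_on \<Omega>) (\<lambda>x. weight x * (norm (g x))\<^sup>2) ((W_norm \<Omega> v)\<^sup>2)"
proof -
  let ?M = "lebesgue_on \<Omega>"
  obtain \<phi> where r: "represents \<Omega> (test_functions \<Omega>) (W_prenorm \<Omega>) \<phi> v"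
    using v by (auto simp: W_space_def completion_of_def)
  obtain g where vs: "square_integrable ?M v" and gs: "square_integrable ?M g"
    and wgs: "square_integrable ?M (\<lambda>x. sqrt_weight x *\<^sub>R g x)"
    and Lg: "L2_tendsto ?M (\<lambda>n. grad (\<phi> n)) g"
    and W: "(\<lambda>n. W_prenorm \<Omega> (\<phi> n)) \<longlonglongrightarrow> sqrt (LINT x|?M. (norm (sqrt_weight x *\<^sub>R g x))\<^sup>2)"
    and ibp: "\<forall>\<eta>\<in>C1_functions \<Omega>. \<forall>b.
      (LINT x|?M. v x * (grad \<eta> x \<bullet> b)) = - (LINT x|?M. (g x \<bullet> b) * \<eta> x)"
    by (rule represents_W_gradient[OF r], rule that)
  let ?n = "sqrt (LINT x|?M. (norm (sqrt_weight x *\<^sub>R g x))\<^sup>2)"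
  have "W_norm \<Omega> v = ?n"
    unfolding W_norm_def completion_norm_def
  proof (rule the_equality)
    show "\<exists>f. represents \<Omega> (test_functions \<Omega>) (W_prenorm \<Omega>) f v \<and> (\<lambda>n. W_prenorm \<Omega> (f n)) \<longlonglongrightarrow> ?n"
      using r W by blast
    fix l assume "\<exists>f. represents \<Omega> (test_functions \<Omega>) (W_prenorm \<Omega>) f v \<and> (\<lambda>n. W_prenorm \<Omega> (f n)) \<longlonglongrightarrow> l"
    then obtain \<psi> where r': "represents \<Omega> (test_functions \<Omega>) (W_prenorm \<Omega>) \<psi> v" and l: "(\<lambda>n. W_prenorm \<Omega> (\<psi> n)) \<longlonglongrightarrow> l"
      by blast
    obtain g' where "square_integrable ?M v" and gs': "square_integrable ?M g'"
      and wgs': "square_integrable ?M (\<lambda>x. sqrt_weight x *\<^sub>R g' x)"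
      and Lg': "L2_tendsto ?M (\<lambda>n. grad (\<psi> n)) g'"
      and W': "(\<lambda>n. W_prenorm \<Omega> (\<psi> n)) \<longlonglongrightarrow> sqrt (LINT x|?M. (norm (sqrt_weight x *\<^sub>R g' x))\<^sup>2)"
      and ibp': "\<forall>\<eta>\<in>C1_functions \<Omega>. \<forall>b.
        (LINT x|?M. v x * (grad \<eta> x \<bullet> b)) = - (LINT x|?M. (g' x \<bullet> b) * \<eta> x)"
      by (rule represents_W_gradient[OF r'], rule that)
    have "AE x in ?M. g x = g' x"
    proof (rule limit_gradient_unique[OF _ _ gs gs' Lg Lg'])
      show "\<phi> n \<in> test_functions \<Omega>" "\<psi> n \<in> test_functions \<Omega>" for n
        using r r' by (auto simp: represents_def)
      show "(LINT x|?M. (g x \<bullet> b) * \<eta> x) = (LINT x|?M. (g' x \<bullet> b) * \<eta> x)" if "\<eta> \<in> C1_functions \<Omega>" for \<eta> b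
        using ibp ibp' that by simp
    qed
    then have "(LINT x|?M. (norm (sqrt_weight x *\<^sub>R g x))\<^sup>2) = (LINT x|?M. (norm (sqrt_weight x *\<^sub>R g' x))\<^sup>2)"
      using wgs wgs' by (intro integral_cong_AE) (auto simp: square_integrable_def)
    then show "l = ?n" using LIMSEQ_unique[OF l W'] by simp
  qed
  then have n2: "(W_norm \<Omega> v)\<^sup>2 = (LINT x|?M. weight x * (norm (g x))\<^sup>2)"
    by (simp add: integral_nonneg_AE power_mult_distrib norm_powr_hardy_exp weight_nonneg)
  have "integrable ?M (\<lambda>x. weight x * (norm (g x))\<^sup>2)"
    using wgs by (simp add: square_integrable_def power_mult_distrib norm_powr_hardy_exp)
  then have hb: "has_bochner_integral ?M (\<lambda>x. weight x * (norm (g x))\<^sup>2) ((W_norm \<Omega> v)\<^sup>2)"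
    unfolding n2 by (rule has_bochner_integral_integrable)
  \<comment> \<open>On a set of finite measure L2 functions are integrable, which yields the local
    integrability demanded of a weak gradient.\<close>
  have fin: "finite_measure ?M"
  proof (rule finite_measureI)
    have "emeasure ?M (space ?M) = emeasure lebesgue \<Omega>"
      using domain_sets by (simp add: emeasure_restrict_space)
    also have "\<dots> \<le> emeasure lebesgue (ball (0::'a) R)" using R by (intro emeasure_mono) auto
    also have "\<dots> < \<infinity>" using emeasure_lborel_ball_finite[of "0::'a" R] by simp
    finally show "emeasure ?M (space ?M) \<noteq> \<infinity>" by simp
  qed
  have "has_weak_gradient \<Omega> v g"
    unfolding has_weak_gradient_def
  proof (intro conjI ballI allI impI)
    fix K assume K: "compact K \<and> K \<subseteq> \<Omega>"
    then have Ks: "K \<in> sets lebesgue" using borel_compact[of K] by (simp add: sets_completionI_sets)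
    have "set_integrable lebesgue \<Omega> v" "set_integrable lebesgue \<Omega> g"
      using square_integrable_imp_integrable[OF fin vs]
        square_integrable_imp_integrable[OF fin gs] domain_sets
      by (simp_all add: set_integrable_def integrable_restrict_space)
    then show "set_integrable lebesgue K v" "set_integrable lebesgue K g"
      using K Ks by (auto intro: set_integrable_subset)
  next
    fix \<eta> assume "\<eta> \<in> test_functions \<Omega>"
    then have \<eta>: "\<eta> \<in> C1_functions \<Omega>" using test_functions_subset_C1 by blast
    note s\<eta> = square_integrable_C1'[OF \<eta>]
    have "(LINT x|?M. v x *\<^sub>R grad \<eta> x) = - (LINT x|?M. \<eta> x *\<^sub>R g x)"
    \<comment> \<open>The vector identity is tested against each basis vector, where it becomes the
      scalar identity \<open>ibp\<close>.\<close>
    proof (rule euclidean_eqI)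
      fix b :: 'a
      have "(LINT x|?M. v x *\<^sub>R grad \<eta> x) \<bullet> b = (LINT x|?M. v x * (grad \<eta> x \<bullet> b))"
        using square_integrable_scaleR[OF vs s\<eta>(2)] by (simp add: integral_inner_left[symmetric])
      also have "\<dots> = - (LINT x|?M. \<eta> x * (g x \<bullet> b))" using ibp \<eta> by (simp add: mult.commute)
      also have "\<dots> = - (LINT x|?M. \<eta> x *\<^sub>R g x) \<bullet> b"
        using square_integrable_scaleR[OF s\<eta>(1) gs] by (simp add: integral_inner_left[symmetric])
      finally show "(LINT x|?M. v x *\<^sub>R grad \<eta> x) \<bullet> b = - (LINT x|?M. \<eta> x *\<^sub>R g x) \<bullet> b" .
    qed
    then show "(LINT x:\<Omega>|lebesgue. v x *\<^sub>R grad \<eta> x) = - (LINT x:\<Omega>|lebesgue. \<eta> x *\<^sub>R g x)"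
      unfolding set_lebesgue_integral_def using domain_sets by (simp add: integral_restrict_space)
  qed
  with hb show ?thesis by blast
qed

end

text \<open>The left side of the displayed identity is \<open>(H_norm \<Omega> u)^2\<close>, because
  its separate terms may diverge for general \<open>u\<close>. On the right \<open>g\<close> is the
  distributional gradient of \<open>v\<close>, and \<open>has_bochner_integral\<close> makes
  integrability part of the claim instead of letting a divergent integral take the value 0.\<close>

theorem lemma1p2:
  fixes \<Omega> :: "'a::euclidean_space set" and u v :: "'a \<Rightarrow> real"
  assumes "DIM('a) \<ge> 3"
    and "open \<Omega>" and "connected \<Omega>" and "bounded \<Omega>" and "0 \<in> \<Omega>"
    and "v = (\<lambda>x. norm x powr ((real DIM('a) - 2) / 2) * u x)"
  shows "(u \<in> H_space \<Omega> \<longleftrightarrow> v \<in> W_space \<Omega>) \<and>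
    (u \<in> H_space \<Omega> \<longrightarrow>
      (H_norm \<Omega> u)\<^sup>2 = (W_norm \<Omega> v)\<^sup>2 \<and>
      (\<exists>g. has_weak_gradient \<Omega> v g \<and>
        has_bochner_integral (lebesgue_on \<Omega>)
          (\<lambda>x. norm x powr (- (real DIM('a) - 2)) * (norm (g x))\<^sup>2) ((H_norm \<Omega> u)\<^sup>2)))"
proof -
  obtain R where R: "R > 0" "\<Omega> \<subseteq> ball 0 R"
    using bounded_subset_ballD[OF assms(4), of 0] by blast
  have v: "v = (\<lambda>x. norm x powr hardy_exp TYPE('a) * u x)"
    by (simp add: assms(6) hardy_exp_def)
  note iff = H_space_iff_W_space[OF assms(1,2) R v]
  note norm = H_norm_eq_W_norm[OF assms(1,2) R v]
  show ?thesis
    using iff norm W_norm_gradient[OF assms(1,2) R, of v] by (auto simp: weight_def)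
qed

end
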